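(* Suppose that the past assortments are nested, $S_1\subset\cdots\subset S_M$, and that $S_1,\dots,S_M\in\mathcal{S}$. Then the robust optimization problem $\max_{S\in\mathcal{S}}\min_{\lambda\in\mathcal{U}}\mathscr{R}^\lambda(S)$ can be reformulated as a mixed-integer linear optimization problem with $\mathcal{O}(n)$ binary decision variables, $\mathcal{O}(\mathrm{poly}(n,M))$ continuous decision variables, and $\mathcal{O}(\mathrm{poly}(n,M))$ constraints.
   Context: Products: $\mathcal{N}=\{1,\dots,n\}$, and $0$ is the no-purchase option; $\mathcal{N}_0=\mathcal{N}\cup\{0\}$. Revenues satisfy $0=r_0<r_1<\cdots<r_n$. An assortment is a subset of $\mathcal{N}_0$, and $\mathcal{S}=\{S\subseteq\mathcal{N}_0: 0\in S\}$. Data: past assortments $S_1,\dots,S_M\subseteq\mathcal{N}_0$ with index set $\mathcal{M}=\{1,\dots,M\}$, and historical sales data $v_{m,i}\in[0,1]$ ($m\in\mathcal{M}$, $i\in\mathcal{N}_0$) with $\sum_{i\in\mathcal{N}_0}v_{m,i}=1$ for each $m$ and $v_{m,i}=0$ for $i\notin S_m$. Standing assumption: $\bigcup_{m\in\mathcal{M}}S_m=\mathcal{N}_0$. Ranking-based choice models: $\Sigma$ is the set of all rankings, i.e. bijections $\sigma:\mathcal{N}_0\to\{0,\dots,n\}$. $\Delta_\Sigma$ is the set of probability distributions $\lambda=(\lambda_\sigma)_{\sigma\in\Sigma}$ on $\Sigma$. For $\lambda\in\Delta_\Sigma$ and an assortment $S$, $\mathscr{D}^\lambda_i(S)=\sum_{\sigma\in\Sigma}\mathbb{I}\{i=\arg\min_{j\in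 S}\sigma(j)\}\lambda_\sigma$ and $\mathscr{R}^\lambda(S)=\sum_{i\in\mathcal{N}_0}r_i\mathscr{D}^\lambda_i(S)$. Uncertainty set: for a radius $\eta\ge 0$ and $\|\cdot\|$ either the $\ell_1$- or $\ell_\infty$-norm, $\mathcal{U}$ is the set of $\lambda\in\Delta_\Sigma$ for which there is a vector $\epsilon=(\epsilon_{m,i})_{m\in\mathcal{M},i\in S_m}$ with $\|\epsilon\|\le\eta$ and $\mathscr{D}^\lambda_i(S_m)-v_{m,i}=\epsilon_{m,i}$ for all $m\in\mathcal{M}$, $i\in S_m$. Standing assumption: $\mathcal{U}\neq\emptyset$. "Can be reformulated as" means equivalence of optimization problems: equal optimal values, with an optimal assortment recoverable from the binary decision variables of an optimal solution. *)

theory Defs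
  imports Complex_Main "HOL-Combinatorics.Permutations"
begin

section \<open>Ranking-based choice models\<close>

text \<open>Products are \<open>{1..n}\<close> and \<open>0\<close> is the no-purchase option.\<close>

definition assortments :: "nat \<Rightarrow> nat set set" where
  "assortments n = {S. S \<subseteq> {0..n} \<and> 0 \<in> S}"

text \<open>The bijections from \<open>{0..n}\<close> to itself, each represented by its extension by the
  identity, so that every ranking is counted exactly once.\<close>

definition rankings :: "nat \<Rightarrow> (nat \<Rightarrow> nat) set" where
  "rankings n = {\<sigma>. \<sigma> permutes {0..n}}"

text \<open>Only the values of \<open>\<lambda>\<close> on \<open>rankings n\<close> are meaningful.\<close>

definition ranking_dists :: "nat \<Rightarrow> ((nat \<Rightarrow> nat) \<Rightarrow> real) set" where
  "ranking_dists n =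
     {l. (\<forall>\<sigma>\<in>rankings n. 0 \<le> l \<sigma>) \<and> (\<Sum>\<sigma>\<in>rankings n. l \<sigma>) = 1}"

definition demand :: "nat \<Rightarrow> ((nat \<Rightarrow> nat) \<Rightarrow> real) \<Rightarrow> nat set \<Rightarrow> nat \<Rightarrow> real" where
  "demand n l S i =
     (\<Sum>\<sigma>\<in>rankings n. of_bool (is_arg_min \<sigma> (\<lambda>j. j \<in> S) i) * l \<sigma>)"

definition revenue ::
  "nat \<Rightarrow> (nat \<Rightarrow> real) \<Rightarrow> ((nat \<Rightarrow> nat) \<Rightarrow> real) \<Rightarrow> nat set \<Rightarrow> real" where
  "revenue n r l S = (\<Sum>i\<in>{0..n}. r i * demand n l S i)"

section \<open>The robust assortment problem\<close>

datatype norm_kind = L1 | Linf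

text \<open>The norm of a vector indexed by the pairs \<open>(m, i)\<close> with \<open>m \<in> {1..M}\<close> and
  \<open>i \<in> Ss m\<close>.\<close>

fun vec_norm :: "norm_kind \<Rightarrow> nat \<Rightarrow> (nat \<Rightarrow> nat set) \<Rightarrow> (nat \<Rightarrow> nat \<Rightarrow> real) \<Rightarrow> real" where
  "vec_norm L1 M Ss e = (\<Sum>(m, i)\<in>Sigma {1..M} Ss. \<bar>e m i\<bar>)"
| "vec_norm Linf M Ss e = Max ((\<lambda>(m, i). \<bar>e m i\<bar>) ` Sigma {1..M} Ss)"

definition uncertainty_set ::
  "norm_kind \<Rightarrow> nat \<Rightarrow> nat \<Rightarrow> (nat \<Rightarrow> nat set) \<Rightarrow> (nat \<Rightarrow> nat \<Rightarrow> real) \<Rightarrow> real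
     \<Rightarrow> ((nat \<Rightarrow> nat) \<Rightarrow> real) set" where
  "uncertainty_set nk n M Ss v \<eta> =
     {l \<in> ranking_dists n. \<exists>e. vec_norm nk M Ss e \<le> \<eta> \<and>
        (\<forall>m\<in>{1..M}. \<forall>i\<in>Ss m. demand n l (Ss m) i - v m i = e m i)}"

definition past_assortments :: "nat \<Rightarrow> nat \<Rightarrow> (nat \<Rightarrow> nat set) \<Rightarrow> bool" where
  "past_assortments n M Ss \<longleftrightarrow>
     (\<forall>m\<in>{1..M}. Ss m \<subseteq> {0..n}) \<and> (\<Union>m\<in>{1..M}. Ss m) = {0..n}"

definition nested :: "nat \<Rightarrow> (nat \<Rightarrow> nat set) \<Rightarrow> bool" where
  "nested M Ss \<longleftrightarrow> (\<forall>m\<in>{1..<M}. Ss m \<subset> Ss (Suc m))"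

definition valid_revenues :: "nat \<Rightarrow> (nat \<Rightarrow> real) \<Rightarrow> bool" where
  "valid_revenues n r \<longleftrightarrow> r 0 = 0 \<and> strict_mono_on {0..n} r"

definition valid_sales :: "nat \<Rightarrow> nat \<Rightarrow> (nat \<Rightarrow> nat set) \<Rightarrow> (nat \<Rightarrow> nat \<Rightarrow> real) \<Rightarrow> bool" where
  "valid_sales n M Ss v \<longleftrightarrow>
     (\<forall>m\<in>{1..M}. (\<forall>i\<in>{0..n}. 0 \<le> v m i \<and> v m i \<le> 1) \<and> (\<Sum>i\<in>{0..n}. v m i) = 1 \<and>
        (\<forall>i\<in>{0..n} - Ss m. v m i = 0))"

text \<open>For a nonempty uncertainty set this infimum is a minimum of a linear function over a
  compact polytope.\<close>

definition worst_case_revenue ::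
  "nat \<Rightarrow> (nat \<Rightarrow> real) \<Rightarrow> ((nat \<Rightarrow> nat) \<Rightarrow> real) set \<Rightarrow> nat set \<Rightarrow> real" where
  "worst_case_revenue n r U S = (INF l\<in>U. revenue n r l S)"

definition robust_value ::
  "nat \<Rightarrow> (nat \<Rightarrow> real) \<Rightarrow> ((nat \<Rightarrow> nat) \<Rightarrow> real) set \<Rightarrow> real" where
  "robust_value n r U = Max (worst_case_revenue n r U ` assortments n)"

section \<open>Mixed-integer linear optimization problems\<close>

text \<open>Maximize \<open>obj_bin \<cdot> x + obj_cont \<cdot> y\<close> subject to the \<open>ncon\<close> inequalities
  \<open>(row_bin k) \<cdot> x + (row_cont k) \<cdot> y \<le> rhs k\<close>, where \<open>x\<close> consists of \<open>nbin\<close> binary and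
  \<open>y\<close> of \<open>ncont\<close> free real variables.  Variables and constraints are numbered from 1; an
  equation counts as two constraints and a sign restriction on \<open>y\<close> as one.  The coefficients
  have an arbitrary type, so that they may also be symbolic expressions in problem data.\<close>

datatype 'a milp = MILP
  (nbin: nat) (ncont: nat) (ncon: nat)
  (obj_bin: "nat \<Rightarrow> 'a") (obj_cont: "nat \<Rightarrow> 'a")
  (row_bin: "nat \<Rightarrow> nat \<Rightarrow> 'a") (row_cont: "nat \<Rightarrow> nat \<Rightarrow> 'a") (rhs: "nat \<Rightarrow> 'a")

definition milp_feasible :: "real milp \<Rightarrow> (nat \<Rightarrow> real) \<Rightarrow> (nat \<Rightarrow> real) \<Rightarrow> bool" where
  "milp_feasible P x y \<longleftrightarrow>
     (\<forall>j\<in>{1..nbin P}. x j \<in> {0, 1}) \<and>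
     (\<forall>k\<in>{1..ncon P}.
        (\<Sum>j\<in>{1..nbin P}. row_bin P k j * x j) + (\<Sum>j\<in>{1..ncont P}. row_cont P k j * y j)
          \<le> rhs P k)"

definition milp_objective :: "real milp \<Rightarrow> (nat \<Rightarrow> real) \<Rightarrow> (nat \<Rightarrow> real) \<Rightarrow> real" where
  "milp_objective P x y =
     (\<Sum>j\<in>{1..nbin P}. obj_bin P j * x j) + (\<Sum>j\<in>{1..ncont P}. obj_cont P j * y j)"

definition milp_optimal :: "real milp \<Rightarrow> (nat \<Rightarrow> real) \<Rightarrow> (nat \<Rightarrow> real) \<Rightarrow> bool" where
  "milp_optimal P x y \<longleftrightarrow> milp_feasible P x y \<and>
     (\<forall>x' y'. milp_feasible P x' y' \<longrightarrow> milp_objective P x' y' \<le> milp_objective P x y)"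

section \<open>Reformulation\<close>

text \<open>If a problem could be chosen freely for each given instance, it could simply contain a
  precomputed optimal assortment and its value.  A reformulation is therefore an
  \<open>affine_coeff milp\<close>: its coefficients are symbolic affine expressions, with integer
  coefficients, in the numerical data \<open>r\<close>, \<open>v\<close>, \<open>\<eta>\<close>, and are evaluated at the data of the
  instance by \<open>eval_coeff\<close>.\<close>

datatype affine_coeff = Affine
  (const_part: int) (rev_part: "nat \<Rightarrow> int") (sales_part: "nat \<Rightarrow> nat \<Rightarrow> int") (radius_part: int)

definition eval_coeff ::
  "nat \<Rightarrow> nat \<Rightarrow> (nat \<Rightarrow> real) \<Rightarrow> (nat \<Rightarrow> nat \<Rightarrow> real) \<Rightarrow> real \<Rightarrow> affine_coeff \<Rightarrow> real" where
  "eval_coeff n M r v \<eta> a =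
     of_int (const_part a) + (\<Sum>i\<in>{0..n}. of_int (rev_part a i) * r i) +
     (\<Sum>m\<in>{1..M}. \<Sum>i\<in>{0..n}. of_int (sales_part a m i) * v m i) + of_int (radius_part a) * \<eta>"

text \<open>The first \<open>n\<close> binary variables indicate which products are offered.\<close>

definition decode :: "nat \<Rightarrow> (nat \<Rightarrow> real) \<Rightarrow> nat set" where
  "decode n x = insert 0 {i \<in> {1..n}. x i = 1}"

definition reformulates ::
  "real milp \<Rightarrow> nat \<Rightarrow> (nat \<Rightarrow> real) \<Rightarrow> ((nat \<Rightarrow> nat) \<Rightarrow> real) set \<Rightarrow> bool" where
  "reformulates P n r U \<longleftrightarrow>
     n \<le> nbin P \<and>
     (\<exists>x y. milp_optimal P x y) \<and>
     (\<forall>x y. milp_optimal P x y \<longrightarrow>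
        milp_objective P x y = robust_value n r U \<and>
        decode n x \<in> assortments n \<and>
        worst_case_revenue n r U (decode n x) = robust_value n r U)"

end

theory Submission
  imports Defs "HOL-Library.FuncSet"
begin

text \<open>For a fixed assortment \<open>S\<close>, the worst case over the uncertainty set is a linear program in the
  distribution \<open>\<lambda>\<close>.  Its dual has a multiplier \<open>\<alpha>\<close> for every observed demand and \<open>\<beta>\<close> for the total
  mass, maximises \<open>\<beta> + \<Sum> v * \<alpha> - \<eta> * \<theta>\<close> with \<open>\<theta>\<close> at least the dual norm of \<open>\<alpha>\<close>, and has one
  constraint for each ranking: \<open>\<beta>\<close> plus the multipliers of the products that the ranking picks from
  the past assortments is at most the revenue of the product that it picks from \<open>S\<close>.  Weak duality
  is \<open>dual_value_le_revenue\<close>; strong duality with attainment, \<open>dual_certificate_exists\<close>, follows from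
  Farkas' lemma.  Maximising over \<open>S\<close> as well merges the two optimisation problems into one, but there
  are \<open>(n + 1)!\<close> constraints, and their right-hand sides depend on \<open>S\<close>.

  Nestedness compresses them.  The choices \<open>p 1, \<dots>, p M\<close> of a ranking from nested assortments form
  a path in a layered graph: the choice from \<open>Ss (m + 1)\<close> is the previous one or a new product.
  Conversely (\<open>purchase_path_realizable\<close>) every such path comes from a ranking, and the ranking can be
  made to pick \<open>j\<close> from \<open>S\<close> if and only if \<open>j \<in> S\<close> and \<open>p m \<notin> S\<close> for all \<open>m\<close> with \<open>j \<in> Ss m\<close> and
  \<open>p m \<noteq> j\<close>.  So the constraints say that, for each product \<open>j\<close>, all paths compatible with the sale of
  \<open>j\<close> have weight at most \<open>r j\<close>.  The compatibility condition is a conjunction of conditions on single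
  nodes of the path.  It can therefore be enforced by a penalty on the nodes, linear in the indicators
  of \<open>S\<close>; the penalty \<open>r n\<close> suffices, because every path has weight at most \<open>r n\<close> anyway
  (\<open>penalised_path_le\<close>).  A bound on all paths of a layered graph is equivalent to the existence of
  node potentials, which gives \<open>O(n M)\<close> continuous variables and \<open>O(n^2 M)\<close> constraints for each of the
  \<open>n + 1\<close> products \<open>j\<close>.  The only binary variables are the \<open>n\<close> indicators of \<open>S\<close>.  All coefficients are
  integers or integer combinations of the data.\<close>

section \<open>Farkas' lemma for linear forms\<close>

definition lin_form :: "(('j \<Rightarrow> real) \<Rightarrow> real) \<Rightarrow> bool" where
  "lin_form f \<longleftrightarrow> (\<forall>x y s. f (\<lambda>j. x j + s * y j) = f x + s * f y)"

lemma lin_form_combine: "lin_form f \<Longrightarrow> f (\<lambda>j. x j + s * y j) = f x + s * f y"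
  unfolding lin_form_def by blast

lemma lin_form_zero: "lin_form f \<Longrightarrow> f (\<lambda>_. 0) = 0"
  using lin_form_combine[of f "\<lambda>_. 0" 1 "\<lambda>_. 0"] by simp

lemma lin_form_scale: "lin_form f \<Longrightarrow> f (\<lambda>j. s * y j) = s * f y"
  using lin_form_combine[of f "\<lambda>_. 0" s y] lin_form_zero[of f] by simp

text \<open>Bartl's induction on the number of forms.  If \<open>c\<close> is not already controlled by the forms in
  \<open>K\<close>, there is a vector \<open>x\<close> on which these forms are nonpositive and \<open>c\<close> is positive, so that the
  new form \<open>a k\<close> must be positive on \<open>x\<close>.  Projecting along \<open>x\<close> onto the kernel of \<open>a k\<close> removes
  \<open>a k\<close> from the problem; the sign conditions on \<open>x\<close> make its multiplier nonnegative when the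
  projection is undone.  The argument never refers to coordinates, and therefore linear forms are
  used here instead of rows of a matrix.\<close>

lemma farkas_homogeneous:
  assumes "finite K" and "\<forall>k\<in>K. lin_form (a k)" and "lin_form c"
    and "\<forall>x. (\<forall>k\<in>K. a k x \<le> 0) \<longrightarrow> c x \<le> 0"
  shows "\<exists>u. (\<forall>k\<in>K. 0 \<le> u k) \<and> (\<forall>x. c x = (\<Sum>k\<in>K. u k * a k x))"
  using assms
proof (induction K arbitrary: a c rule: finite_induct)
  case empty
  have "c x = 0" for x
  proof -
    have "c x \<le> 0" "c (\<lambda>j. - 1 * x j) \<le> 0" using empty by auto
    then show ?thesis using lin_form_scale[OF empty(2), of "-1" x] by simp
  qed
  then show ?case by simp
next
  case (insert k K)
  show ?case
  proof (cases "\<forall>x. (\<forall>i\<in>K. a i x \<le> 0) \<longrightarrow> c x \<le> 0")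
    case True
    then obtain u where u: "\<forall>i\<in>K. 0 \<le> u i" "\<forall>x. c x = (\<Sum>i\<in>K. u i * a i x)"
      using insert.IH[of a c] insert.prems by auto
    have "(\<Sum>i\<in>K. (u(k := 0)) i * a i x) = (\<Sum>i\<in>K. u i * a i x)" for x
      using insert.hyps by (intro sum.cong) auto
    then show ?thesis
      using u insert.hyps by (intro exI[of _ "u(k := 0)"]) auto
  next
    case False
    then obtain x0 where x0: "\<forall>i\<in>K. a i x0 \<le> 0" "c x0 > 0" by force
    then have pos: "a k x0 > 0" using insert.prems(3) by force
    \<comment> \<open>a direction in which only the form \<open>a k\<close> obstructs \<open>c\<close>, normalised to \<open>a k x = 1\<close>\<close>
    define x where "x = (\<lambda>j. inverse (a k x0) * x0 j)"
    have lin: "lin_form (a i)" if "i \<in> insert k K" for i using insert.prems(1) that by blast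
    have x_le: "a i x \<le> 0" if "i \<in> K" for i
      using x0 pos that lin_form_scale[OF lin, of i "inverse (a k x0)" x0]
      unfolding x_def by (simp add: mult_le_0_iff)
    have x_k: "a k x = 1"
      using pos lin_form_scale[OF lin, of k "inverse (a k x0)" x0] unfolding x_def by simp
    have x_c: "c x > 0"
      using x0 pos lin_form_scale[OF insert.prems(2), of "inverse (a k x0)" x0]
      unfolding x_def by simp
    define a' where "a' = (\<lambda>i y. a i y - a i x * a k y)"
    define c' where "c' = (\<lambda>y. c y - c x * a k y)"
    have lin': "\<forall>i\<in>K. lin_form (a' i)" "lin_form c'"
      using insert.prems(1,2) unfolding lin_form_def a'_def c'_def
      by (simp_all add: algebra_simps)
    have "c' y \<le> 0" if y: "\<forall>i\<in>K. a' i y \<le> 0" for y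
    proof -
      define z where "z = (\<lambda>j. y j + (- a k y) * x j)"
      have az: "a i z = a i y - a k y * a i x" if "i \<in> insert k K" for i
        using lin_form_combine[OF lin[OF that], of y "- a k y" x] unfolding z_def by simp
      have "a i z \<le> 0" if i: "i \<in> insert k K" for i
        using az[OF i] y x_k i unfolding a'_def by (auto simp: algebra_simps)
      then have "c z \<le> 0" using insert.prems(3) by blast
      then show ?thesis
        using lin_form_combine[OF insert.prems(2), of y "- a k y" x]
        unfolding z_def c'_def by (simp add: algebra_simps)
    qed
    then obtain u where u: "\<forall>i\<in>K. 0 \<le> u i" "\<And>y. c' y = (\<Sum>i\<in>K. u i * a' i y)"
      using insert.IH[of a' c'] lin' by auto
    define uk where "uk = c x - (\<Sum>i\<in>K. u i * a i x)"
    have "(\<Sum>i\<in>K. u i * a i x) \<le> 0"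
      using u(1) x_le by (intro sum_nonpos) (simp add: mult_le_0_iff)
    then have uk: "uk \<ge> 0" using x_c unfolding uk_def by simp
    have "c y = uk * a k y + (\<Sum>i\<in>K. u i * a i y)" for y
    proof -
      have "c y = c x * a k y + (\<Sum>i\<in>K. u i * a' i y)"
        using u(2)[of y] unfolding c'_def by simp
      also have "(\<Sum>i\<in>K. u i * a' i y)
          = (\<Sum>i\<in>K. u i * a i y) - (\<Sum>i\<in>K. u i * a i x) * a k y"
        unfolding a'_def by (simp add: algebra_simps sum_subtractf sum_distrib_left)
      finally show ?thesis unfolding uk_def by (simp add: algebra_simps)
    qed
    moreover have "(\<Sum>i\<in>K. (u(k := uk)) i * a i y) = (\<Sum>i\<in>K. u i * a i y)" for y
      using insert.hyps by (intro sum.cong) auto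
    ultimately show ?thesis
      using u(1) uk insert.hyps by (intro exI[of _ "u(k := uk)"]) auto
  qed
qed

text \<open>Homogenisation: with an extra variable \<open>s\<close> (index \<open>None\<close>), a point with \<open>s > 0\<close> of the
  cone \<open>a k x \<le> s * b k\<close>, \<open>s \<ge> 0\<close> rescales to a solution of the affine system.  If the system is
  infeasible, the form \<open>s\<close> is thus nonpositive on the cone, and its representation by the
  homogeneous lemma is the certificate.\<close>

lemma farkas_affine:
  assumes fin: "finite K" and lin: "\<forall>k\<in>K. lin_form (a k)"
    and infeasible: "\<not> (\<exists>x. \<forall>k\<in>K. a k x \<le> b k)"
  obtains u where "\<forall>k\<in>K. 0 \<le> u k" "\<And>x. (\<Sum>k\<in>K. u k * a k x) = 0"
    "(\<Sum>k\<in>K. u k * b k) < 0"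
proof -
  define A where "A = (\<lambda>q (x :: 'b option \<Rightarrow> real).
    case q of None \<Rightarrow> - x None | Some k \<Rightarrow> a k (\<lambda>j. x (Some j)) - b k * x None)"
  define K' where "K' = insert None (Some ` K)"
  have linA: "\<forall>q\<in>K'. lin_form (A q)"
    using lin unfolding K'_def A_def lin_form_def by (auto simp: algebra_simps)
  have "x None \<le> 0" if x: "\<forall>q\<in>K'. A q x \<le> 0" for x
  proof (rule ccontr)
    assume "\<not> x None \<le> 0"
    then have pos: "x None > 0" by simp
    have "a k (\<lambda>j. inverse (x None) * x (Some j)) \<le> b k" if "k \<in> K" for k
    proof -
      have "a k (\<lambda>j. x (Some j)) \<le> b k * x None"
        using x that unfolding K'_def A_def by auto
      then have "inverse (x None) * a k (\<lambda>j. x (Some j)) \<le> b k"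
        using pos by (simp add: field_simps)
      then show ?thesis
        using lin_form_scale[of "a k" "inverse (x None)" "\<lambda>j. x (Some j)"] lin that by simp
    qed
    then show False using infeasible by blast
  qed
  moreover have "lin_form (\<lambda>x :: 'b option \<Rightarrow> real. x None)"
    unfolding lin_form_def by simp
  ultimately obtain u where u: "\<forall>q\<in>K'. 0 \<le> u q"
    "\<And>x :: 'b option \<Rightarrow> real. x None = (\<Sum>q\<in>K'. u q * A q x)"
    using farkas_homogeneous[of K' A "\<lambda>x. x None"] linA fin unfolding K'_def by auto
  have eq: "x None = - (u None * x None) +
      (\<Sum>k\<in>K. u (Some k) * (a k (\<lambda>j. x (Some j)) - b k * x None))"
    for x :: "'b option \<Rightarrow> real"
    using u(2)[of x] fin unfolding K'_def A_def by (simp add: sum.reindex)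
  show thesis
  proof (rule that[of "\<lambda>k. u (Some k)"])
    show "\<forall>k\<in>K. 0 \<le> u (Some k)" using u(1) unfolding K'_def by simp
    show "(\<Sum>k\<in>K. u (Some k) * a k x) = 0" for x
      using eq[of "\<lambda>q. case q of None \<Rightarrow> 0 | Some j \<Rightarrow> x j"] by simp
    have "(\<Sum>k\<in>K. u (Some k) * (a k (\<lambda>_. 0) - b k)) = (\<Sum>k\<in>K. - (u (Some k) * b k))"
      using lin by (intro sum.cong) (simp_all add: lin_form_zero[of "a _"])
    then have "(1 :: real) = - u None - (\<Sum>k\<in>K. u (Some k) * b k)"
      using eq[of "\<lambda>q. case q of None \<Rightarrow> 1 | Some j \<Rightarrow> 0"] by (simp add: sum_negf)
    moreover have "0 \<le> u None" using u(1) unfolding K'_def by simp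
    ultimately show "(\<Sum>k\<in>K. u (Some k) * b k) < 0" by simp
  qed
qed

section \<open>Rankings and the choices they induce\<close>

definition favourite :: "(nat \<Rightarrow> nat) \<Rightarrow> nat set \<Rightarrow> nat" where
  "favourite \<sigma> S = arg_min \<sigma> (\<lambda>j. j \<in> S)"

lemma favourite_in: "S \<noteq> {} \<Longrightarrow> favourite \<sigma> S \<in> S"
  unfolding favourite_def using arg_min_natI[of "\<lambda>j. j \<in> S" _ \<sigma>] by blast

lemma favourite_le: "k \<in> S \<Longrightarrow> \<sigma> (favourite \<sigma> S) \<le> \<sigma> k"
  unfolding favourite_def using arg_min_nat_le[of "\<lambda>j. j \<in> S" k \<sigma>] by blast

lemma favourite_eqI:
  assumes "i \<in> S" and "\<And>k. k \<in> S \<Longrightarrow> k \<noteq> i \<Longrightarrow> \<sigma> i < \<sigma> k"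
  shows "favourite \<sigma> S = i"
  using assms favourite_in[of S \<sigma>] favourite_le[of i S \<sigma>] by (metis empty_iff not_less)

lemma is_arg_min_iff_favourite:
  assumes "inj \<sigma>" "S \<noteq> {}"
  shows "is_arg_min \<sigma> (\<lambda>j. j \<in> S) i \<longleftrightarrow> i = favourite \<sigma> S"
proof
  assume "is_arg_min \<sigma> (\<lambda>j. j \<in> S) i"
  then have "i \<in> S" "\<sigma> i \<le> \<sigma> (favourite \<sigma> S)"
    using favourite_in[OF assms(2)] unfolding is_arg_min_linorder by auto
  then have "\<sigma> i = \<sigma> (favourite \<sigma> S)" using favourite_le[of i S \<sigma>] by simp
  then show "i = favourite \<sigma> S" using assms(1) by (simp add: inj_eq)
next
  assume "i = favourite \<sigma> S"
  then show "is_arg_min \<sigma> (\<lambda>j. j \<in> S) i"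
    using favourite_in[OF assms(2)] favourite_le unfolding is_arg_min_linorder by auto
qed

lemma finite_rankings: "finite (rankings n)"
  unfolding rankings_def by (simp add: finite_permutations)

lemma inj_ranking: "\<sigma> \<in> rankings n \<Longrightarrow> inj \<sigma>"
  unfolding rankings_def by (simp add: permutes_inj)

lemma demand_favourite:
  assumes "S \<noteq> {}"
  shows "demand n l S i = (\<Sum>\<sigma>\<in>rankings n. of_bool (i = favourite \<sigma> S) * l \<sigma>)"
  unfolding demand_def using assms
  by (intro sum.cong) (simp_all add: is_arg_min_iff_favourite inj_ranking)

text \<open>Demand sums are sums over rankings in disguise, which is how the dual linear program acquires
  one constraint per ranking.\<close>

lemma sum_demand:
  assumes S: "S \<subseteq> {0..n}" "S \<noteq> {}" and A: "S \<subseteq> A" "finite A"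
  shows "(\<Sum>i\<in>A. f i * demand n l S i) = (\<Sum>\<sigma>\<in>rankings n. l \<sigma> * f (favourite \<sigma> S))"
proof -
  have "(\<Sum>i\<in>A. f i * demand n l S i)
      = (\<Sum>i\<in>A. \<Sum>\<sigma>\<in>rankings n. f i * (of_bool (i = favourite \<sigma> S) * l \<sigma>))"
    using S by (simp add: demand_favourite sum_distrib_left)
  also have "\<dots> = (\<Sum>\<sigma>\<in>rankings n. \<Sum>i\<in>A. f i * (of_bool (i = favourite \<sigma> S) * l \<sigma>))"
    by (rule sum.swap)
  also have "\<dots> = (\<Sum>\<sigma>\<in>rankings n. l \<sigma> * f (favourite \<sigma> S))"
  proof (intro sum.cong refl)
    fix \<sigma>
    have "favourite \<sigma> S \<in> A" using favourite_in[OF S(2)] A by blast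
    have "(\<Sum>i\<in>A. f i * (of_bool (i = favourite \<sigma> S) * l \<sigma>))
        = (\<Sum>i\<in>A. if i = favourite \<sigma> S then l \<sigma> * f i else 0)"
      by (intro sum.cong) auto
    also have "\<dots> = l \<sigma> * f (favourite \<sigma> S)"
      using \<open>favourite \<sigma> S \<in> A\<close> A by simp
    finally show "(\<Sum>i\<in>A. f i * (of_bool (i = favourite \<sigma> S) * l \<sigma>))
      = l \<sigma> * f (favourite \<sigma> S)" .
  qed
  finally show ?thesis .
qed

lemma revenue_favourite:
  assumes "S \<in> assortments n"
  shows "revenue n r l S = (\<Sum>\<sigma>\<in>rankings n. l \<sigma> * r (favourite \<sigma> S))"
  unfolding revenue_def using assms by (intro sum_demand) (auto simp: assortments_def)

text \<open>Sort \<open>{0..n}\<close> by the key, breaking ties by the product number: the rank of \<open>a\<close> is the number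
  of products that come before it.\<close>

lemma ranking_from_key:
  fixes key :: "nat \<Rightarrow> nat"
  obtains \<sigma> where "\<sigma> \<in> rankings n"
    "\<And>a b. a \<le> n \<Longrightarrow> b \<le> n \<Longrightarrow> key a < key b \<Longrightarrow> \<sigma> a < \<sigma> b"
proof -
  \<comment> \<open>the lexicographic order on \<open>(key a, a)\<close>, as a single number because \<open>a \<le> n\<close>\<close>
  define h where "h = (\<lambda>a. key a * Suc n + a)"
  have h_less: "h a < h b" if "a \<le> n" "key a < key b" for a b
  proof -
    have "h a < Suc (key a) * Suc n" using that unfolding h_def by simp
    also have "\<dots> \<le> key b * Suc n" using that by (intro mult_right_mono) auto
    finally show ?thesis unfolding h_def by simp
  qed
  have h_inj: "h a \<noteq> h b" if "a \<le> n" "b \<le> n" "a \<noteq> b" for a b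
    using h_less[of a b] h_less[of b a] that unfolding h_def
    by (cases "key a" "key b" rule: linorder_cases) auto
  define \<sigma> where "\<sigma> = (\<lambda>a. if a \<in> {0..n} then card {b \<in> {0..n}. h b < h a} else a)"
  have mono: "\<sigma> a < \<sigma> b" if "a \<le> n" "b \<le> n" "h a < h b" for a b
  proof -
    have "{c \<in> {0..n}. h c < h a} \<subset> {c \<in> {0..n}. h c < h b}"
      using that by (auto intro: less_trans)
    then show ?thesis using that unfolding \<sigma>_def by (simp add: psubset_card_mono)
  qed
  have "inj_on \<sigma> {0..n}"
  proof (rule inj_onI)
    fix a b assume "a \<in> {0..n}" "b \<in> {0..n}" "\<sigma> a = \<sigma> b"
    then show "a = b" using mono[of a b] mono[of b a] h_inj[of a b] by fastforce
  qed
  moreover have "\<sigma> ` {0..n} \<subseteq> {0..n}"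
  proof (rule image_subsetI)
    fix a assume a: "a \<in> {0..n}"
    have "{b \<in> {0..n}. h b < h a} \<subset> {0..n}" using a less_irrefl[of "h a"] by blast
    then have "card {b \<in> {0..n}. h b < h a} < card {0..n}" by (rule psubset_card_mono[rotated]) simp
    then show "\<sigma> a \<in> {0..n}" using a unfolding \<sigma>_def by simp
  qed
  ultimately have "bij_betw \<sigma> {0..n} {0..n}"
    unfolding bij_betw_def using endo_inj_surj[of "{0..n}" \<sigma>] by blast
  then have "\<sigma> permutes {0..n}"
    by (rule bij_imp_permutes) (simp add: \<sigma>_def)
  then show thesis using that mono h_less unfolding rankings_def by blast
qed

section \<open>Purchase paths of a nested history\<close>

locale nested_history =
  fixes n M :: nat and Ss :: "nat \<Rightarrow> nat set"
  assumes past: "past_assortments n M Ss" and nest: "nested M Ss"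
    and no_purchase: "\<forall>m\<in>{1..M}. Ss m \<in> assortments n"
begin

lemma M_pos: "1 \<le> M"
  using past unfolding past_assortments_def by (cases M) auto

lemma Ss_subset: "m \<in> {1..M} \<Longrightarrow> Ss m \<subseteq> {0..n}"
  using no_purchase unfolding assortments_def by blast

lemma Ss_le: "i \<in> Ss m \<Longrightarrow> m \<in> {1..M} \<Longrightarrow> i \<le> n"
  using subsetD[OF Ss_subset, of m i] by simp

lemma Ss_nonempty: "m \<in> {1..M} \<Longrightarrow> Ss m \<noteq> {}"
  using no_purchase unfolding assortments_def by blast

lemma Ss_mono:
  assumes "m \<le> m'" "1 \<le> m" "m' \<le> M"
  shows "Ss m \<subseteq> Ss m'"
  using assms
proof (induction m' rule: dec_induct)
  case (step k)
  have "Ss k \<subset> Ss (Suc k)" using nest step unfolding nested_def by simp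
  then show ?case using step by auto
qed simp

text \<open>The choices \<open>p 1, p 2, \<dots>\<close> of one customer along the growing assortments.  The choice can
  only change to a newly added product, and this local condition is the reason why longest paths
  can be computed by dynamic programming.  The length \<open>m\<close> is a parameter so that paths can be
  extended one assortment at a time.\<close>

definition purchase_path :: "nat \<Rightarrow> (nat \<Rightarrow> nat) \<Rightarrow> bool" where
  "purchase_path m p \<longleftrightarrow> (\<forall>k\<in>{1..m}. p k \<in> Ss k) \<and>
     (\<forall>k\<in>{1..<m}. p (Suc k) \<in> Ss k \<longrightarrow> p (Suc k) = p k)"

lemma purchase_path_back:
  assumes p: "purchase_path M p" and m: "m \<le> m'" "1 \<le> m" "m' \<le> M" and in_m: "p m' \<in> Ss m"
  shows "p m' = p m"
  using m in_m
proof (induction m' rule: dec_induct)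
  case (step k)
  have "p (Suc k) \<in> Ss k" using Ss_mono[of m k] step by auto
  then have "p (Suc k) = p k" using p step unfolding purchase_path_def by simp
  then show ?case using step by simp
qed simp

text \<open>The ranking has to reproduce the path and, in addition, to pick \<open>j\<close> from a new assortment \<open>S\<close>,
  which is possible because the path reveals no preference for another product of \<open>S\<close> over \<open>j\<close>.
  Rank the products by the number of past assortments in which they were available but not
  chosen.  By nestedness, whenever \<open>p m\<close> is not chosen from a later assortment, no other product of
  \<open>Ss m\<close> is chosen there either, and such a product also loses at \<open>m\<close>; hence \<open>p m\<close> has strictly
  fewer losses than the rest of \<open>Ss m\<close>.  To make \<open>j\<close> the favourite of \<open>S\<close>, the keys of the other
  products of \<open>S\<close> are lifted above that of \<open>j\<close>; the hypothesis \<open>free\<close> guarantees that this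
  does not disturb the path.\<close>

lemma purchase_path_realizable:
  assumes p: "purchase_path M p" and S: "S \<subseteq> {0..n}" "j \<in> S"
    and free: "\<And>m. m \<in> {1..M} \<Longrightarrow> j \<in> Ss m \<Longrightarrow> p m \<in> S \<Longrightarrow> p m = j"
  obtains \<sigma> where "\<sigma> \<in> rankings n" "\<And>m. m \<in> {1..M} \<Longrightarrow> favourite \<sigma> (Ss m) = p m"
    "favourite \<sigma> S = j"
proof -
  define losses where "losses = (\<lambda>k. {m \<in> {1..M}. k \<in> Ss m \<and> p m \<noteq> k})"
  define L where "L = (\<lambda>k. card (losses k))"
  define key where "key = (\<lambda>k. if k \<in> S - {j} then 2 * max (L k) (L j) + 1 else 2 * L k)"
  \<comment> \<open>doubling the counts leaves room for the lifted keys strictly between two counts\<close>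
  have L_key: "2 * L k \<le> key k" for k unfolding key_def by auto
  have fin: "finite (losses k)" for k unfolding losses_def by simp
  have path_less: "key (p m) < key k" if m: "m \<in> {1..M}" and k: "k \<in> Ss m" "k \<noteq> p m" for m k
  proof -
    have m_loss: "m \<in> losses k" using m k unfolding losses_def by auto
    have later: "m < m'" if "m' \<in> losses (p m)" for m'
    proof (rule ccontr)
      assume "\<not> m < m'"
      then show False
        using that purchase_path_back[OF p, of m' m] m unfolding losses_def by auto
    qed
    have "losses (p m) \<subseteq> losses k"
    proof
      fix m' assume m': "m' \<in> losses (p m)"
      have "k \<in> Ss m'" using Ss_mono[of m m'] later[OF m'] m m' k unfolding losses_def by auto
      moreover have "p m' \<noteq> k"
        using purchase_path_back[OF p, of m m'] later[OF m'] m m' k unfolding losses_def by auto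
      ultimately show "m' \<in> losses k" using m' unfolding losses_def by simp
    qed
    moreover have "m \<notin> losses (p m)" unfolding losses_def by simp
    ultimately have L_less: "L (p m) < L k"
      unfolding L_def using fin m_loss by (intro psubset_card_mono) auto
    show ?thesis
    proof (cases "p m \<in> S - {j}")
      case False
      then show ?thesis using L_less L_key[of k] unfolding key_def by auto
    next
      case True
      then have j_m: "j \<notin> Ss m" using free[OF m] by auto
      \<comment> \<open>\<open>j\<close> only becomes available after \<open>m\<close>; where it loses, the path avoids \<open>S\<close>, hence has
        left \<open>p m\<close>, and so has left \<open>Ss m\<close>, which makes \<open>k\<close> lose as well\<close>
      have "losses j \<subseteq> losses k"
      proof
        fix m' assume m': "m' \<in> losses j"
        have less: "m < m'"
        proof (rule ccontr)
          assume "\<not> m < m'"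
          then show False using Ss_mono[of m' m] m m' j_m unfolding losses_def by auto
        qed
        have "p m' \<notin> S" using free[of m'] m' unfolding losses_def by auto
        then have "p m' \<noteq> k"
          using purchase_path_back[OF p, of m m'] less m m' k True unfolding losses_def by auto
        moreover have "k \<in> Ss m'"
          using Ss_mono[of m m'] less m m' k unfolding losses_def by auto
        ultimately show "m' \<in> losses k" using m' unfolding losses_def by simp
      qed
      moreover have "m \<notin> losses j" using j_m unfolding losses_def by simp
      ultimately have "L j < L k"
        unfolding L_def using fin m_loss by (intro psubset_card_mono) auto
      then have "key (p m) < 2 * L k" using L_less True unfolding key_def by auto
      then show ?thesis using L_key[of k] by simp
    qed
  qed
  obtain \<sigma> where \<sigma>: "\<sigma> \<in> rankings n"
    "\<And>a b. a \<le> n \<Longrightarrow> b \<le> n \<Longrightarrow> key a < key b \<Longrightarrow> \<sigma> a < \<sigma> b"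
    using ranking_from_key[of n key] by blast
  show thesis
  proof (rule that[OF \<sigma>(1)])
    fix m assume m: "m \<in> {1..M}"
    have pm: "p m \<in> Ss m" using p m unfolding purchase_path_def by simp
    show "favourite \<sigma> (Ss m) = p m"
    proof (rule favourite_eqI[OF pm])
      fix k assume k: "k \<in> Ss m" "k \<noteq> p m"
      show "\<sigma> (p m) < \<sigma> k"
        using \<sigma>(2)[of "p m" k] path_less[OF m k] subsetD[OF Ss_subset[OF m] pm]
          subsetD[OF Ss_subset[OF m] k(1)] by simp
    qed
  next
    show "favourite \<sigma> S = j"
    proof (rule favourite_eqI[OF S(2)])
      fix k assume k: "k \<in> S" "k \<noteq> j"
      then have "key j < key k" unfolding key_def by auto
      then show "\<sigma> j < \<sigma> k"
        using \<sigma>(2)[of j k] subsetD[OF S(1) S(2)] subsetD[OF S(1) k(1)] by simp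
    qed
  qed
qed

end

section \<open>Linear programming duality for the worst case\<close>

text \<open>\<open>Alpha m i\<close> is the multiplier of the demand for \<open>i\<close> under the past assortment \<open>m\<close>, \<open>Beta\<close> that
  of the normalisation of the distribution.  \<open>Tau m i\<close> bounds the modulus of \<open>Alpha m i\<close> and
  \<open>Theta\<close> the dual norm of all of \<open>Alpha\<close>.  The variables \<open>Pot j m i\<close> are not multipliers of the
  worst-case problem: they are the path potentials that compress its dual.\<close>

datatype dual_var = Alpha nat nat | Tau nat nat | Beta | Theta | Pot nat nat nat

context nested_history
begin

definition observations :: "(nat \<times> nat) set" where
  "observations = Sigma {1..M} Ss"

lemma finite_Ss: "m \<in> {1..M} \<Longrightarrow> finite (Ss m)"
  using Ss_subset finite_subset by blast

lemma finite_observations: "finite observations"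
  unfolding observations_def by (intro finite_SigmaI finite_Ss) auto

lemma observations_nonempty: "observations \<noteq> {}"
  using Ss_nonempty[of 1] M_pos unfolding observations_def by fastforce

lemma vec_norm_Linf_le_iff:
  "vec_norm Linf M Ss e \<le> c \<longleftrightarrow> (\<forall>(m, i)\<in>observations. \<bar>e m i\<bar> \<le> c)"
  using finite_observations observations_nonempty
  unfolding vec_norm.simps observations_def by (subst Max_le_iff) auto

text \<open>The dual of the \<open>l\<^sub>1\<close>-norm is the \<open>l\<^sub>\<infinity>\<close>-norm and conversely, so that the two cases are
  exchanged here.\<close>

definition dominates_dual_norm :: "norm_kind \<Rightarrow> (dual_var \<Rightarrow> real) \<Rightarrow> bool" where
  "dominates_dual_norm nk y \<longleftrightarrow>
     (\<forall>(m, i)\<in>observations. \<bar>y (Alpha m i)\<bar> \<le> y (Tau m i)) \<and>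
     (case nk of
        L1 \<Rightarrow> \<forall>(m, i)\<in>observations. y (Tau m i) \<le> y Theta
      | Linf \<Rightarrow> (\<Sum>(m, i)\<in>observations. y (Tau m i)) \<le> y Theta)"

definition dual_value ::
  "(nat \<Rightarrow> nat \<Rightarrow> real) \<Rightarrow> real \<Rightarrow> (dual_var \<Rightarrow> real) \<Rightarrow> real" where
  "dual_value v \<eta> y =
     y Beta + (\<Sum>m\<in>{1..M}. \<Sum>i\<in>{0..n}. v m i * y (Alpha m i)) - \<eta> * y Theta"

text \<open>The exponentially many constraints of the dual linear program, one for each ranking.\<close>

definition ranking_bound :: "(nat \<Rightarrow> real) \<Rightarrow> nat set \<Rightarrow> (dual_var \<Rightarrow> real) \<Rightarrow> bool" where
  "ranking_bound r S y \<longleftrightarrow> (\<forall>\<sigma>\<in>rankings n.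
     y Beta + (\<Sum>m\<in>{1..M}. y (Alpha m (favourite \<sigma> (Ss m)))) \<le> r (favourite \<sigma> S))"

lemma sales_sum:
  assumes "valid_sales n M Ss v"
  shows "(\<Sum>m\<in>{1..M}. \<Sum>i\<in>{0..n}. v m i * f m i) = (\<Sum>(m, i)\<in>observations. v m i * f m i)"
proof -
  have "(\<Sum>i\<in>{0..n}. v m i * f m i) = (\<Sum>i\<in>Ss m. v m i * f m i)" if "m \<in> {1..M}" for m
    using assms that Ss_subset[OF that] unfolding valid_sales_def
    by (intro sum.mono_neutral_right) auto
  then show ?thesis
    unfolding observations_def by (simp add: sum.Sigma finite_Ss)
qed

lemma demand_sum:
  "(\<Sum>(m, i)\<in>observations. f m i * demand n l (Ss m) i)
    = (\<Sum>\<sigma>\<in>rankings n. l \<sigma> * (\<Sum>m\<in>{1..M}. f m (favourite \<sigma> (Ss m))))"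
proof -
  have "(\<Sum>(m, i)\<in>observations. f m i * demand n l (Ss m) i)
      = (\<Sum>m\<in>{1..M}. \<Sum>i\<in>Ss m. f m i * demand n l (Ss m) i)"
    unfolding observations_def by (simp add: sum.Sigma finite_Ss)
  also have "\<dots> = (\<Sum>m\<in>{1..M}. \<Sum>\<sigma>\<in>rankings n. l \<sigma> * f m (favourite \<sigma> (Ss m)))"
    using Ss_subset Ss_nonempty by (intro sum.cong sum_demand) (auto simp: finite_Ss)
  also have "\<dots> = (\<Sum>\<sigma>\<in>rankings n. l \<sigma> * (\<Sum>m\<in>{1..M}. f m (favourite \<sigma> (Ss m))))"
    by (subst sum.swap) (simp add: sum_distrib_left)
  finally show ?thesis .
qed

text \<open>The Hoelder inequality for the two norms.\<close>

lemma dual_norm_pairing: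
  assumes norm: "vec_norm nk M Ss e \<le> \<eta>" and dom: "dominates_dual_norm nk y"
  shows "- (\<eta> * y Theta) \<le> (\<Sum>(m, i)\<in>observations. e m i * y (Alpha m i))"
proof -
  have alpha: "\<bar>y (Alpha m i)\<bar> \<le> y (Tau m i)" if "(m, i) \<in> observations" for m i
    using dom that unfolding dominates_dual_norm_def by auto
  have "(\<Sum>(m, i)\<in>observations. \<bar>e m i\<bar> * \<bar>y (Alpha m i)\<bar>) \<le> \<eta> * y Theta"
  proof (cases nk)
    case L1
    have tau: "y (Tau m i) \<le> y Theta" if "(m, i) \<in> observations" for m i
      using dom that L1 unfolding dominates_dual_norm_def by auto
    have "0 \<le> y Theta"
      using observations_nonempty alpha tau by (force intro: order_trans[OF abs_ge_zero])
    have "(\<Sum>(m, i)\<in>observations. \<bar>e m i\<bar> * \<bar>y (Alpha m i)\<bar>)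
        \<le> (\<Sum>(m, i)\<in>observations. \<bar>e m i\<bar> * y Theta)"
      by (intro sum_mono) (auto intro!: mult_left_mono order_trans[OF alpha tau])
    also have "\<dots> = vec_norm nk M Ss e * y Theta"
      using L1 unfolding observations_def by (simp add: sum_distrib_right case_prod_unfold)
    also have "\<dots> \<le> \<eta> * y Theta" using norm \<open>0 \<le> y Theta\<close> by (rule mult_right_mono)
    finally show ?thesis .
  next
    case Linf
    have e: "\<bar>e m i\<bar> \<le> \<eta>" if "(m, i) \<in> observations" for m i
      using norm that Linf vec_norm_Linf_le_iff by auto
    have "0 \<le> \<eta>" using observations_nonempty e by (force intro: order_trans[OF abs_ge_zero])
    have "(\<Sum>(m, i)\<in>observations. \<bar>e m i\<bar> * \<bar>y (Alpha m i)\<bar>)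
        \<le> (\<Sum>(m, i)\<in>observations. \<eta> * y (Tau m i))"
      using alpha e \<open>0 \<le> \<eta>\<close> by (intro sum_mono) (auto intro!: mult_mono)
    also have "\<dots> = \<eta> * (\<Sum>(m, i)\<in>observations. y (Tau m i))"
      by (simp add: sum_distrib_left case_prod_unfold)
    also have "\<dots> \<le> \<eta> * y Theta"
      using dom Linf \<open>0 \<le> \<eta>\<close> unfolding dominates_dual_norm_def
      by (intro mult_left_mono) auto
    finally show ?thesis .
  qed
  moreover have "- (\<Sum>(m, i)\<in>observations. \<bar>e m i\<bar> * \<bar>y (Alpha m i)\<bar>)
      \<le> (\<Sum>(m, i)\<in>observations. e m i * y (Alpha m i))"
    unfolding sum_negf[symmetric] by (intro sum_mono) (auto simp flip: abs_mult)
  ultimately show ?thesis by linarith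
qed

text \<open>Weak duality: average the constraints in \<open>ranking_bound\<close> over the distribution and absorb the
  deviation from the sales data with \<open>dual_norm_pairing\<close>.\<close>

lemma dual_value_le_revenue:
  assumes sales: "valid_sales n M Ss v" and S: "S \<in> assortments n"
    and l: "l \<in> uncertainty_set nk n M Ss v \<eta>"
    and dom: "dominates_dual_norm nk y" and bound: "ranking_bound r S y"
  shows "dual_value v \<eta> y \<le> revenue n r l S"
proof -
  obtain e where e: "vec_norm nk M Ss e \<le> \<eta>"
    "\<And>m i. (m, i) \<in> observations \<Longrightarrow> e m i = demand n l (Ss m) i - v m i"
    using l unfolding uncertainty_set_def observations_def by auto
  have l_dist: "\<And>\<sigma>. \<sigma> \<in> rankings n \<Longrightarrow> 0 \<le> l \<sigma>" "(\<Sum>\<sigma>\<in>rankings n. l \<sigma>) = 1"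
    using l unfolding uncertainty_set_def ranking_dists_def by auto
  have "(\<Sum>(m, i)\<in>observations. e m i * y (Alpha m i))
      = (\<Sum>(m, i)\<in>observations. y (Alpha m i) * demand n l (Ss m) i)
        - (\<Sum>(m, i)\<in>observations. v m i * y (Alpha m i))"
    unfolding sum_subtractf[symmetric]
    by (intro sum.cong) (auto simp: e(2) algebra_simps)
  then have "dual_value v \<eta> y
      \<le> y Beta + (\<Sum>(m, i)\<in>observations. y (Alpha m i) * demand n l (Ss m) i)"
    using dual_norm_pairing[OF e(1) dom] sales_sum[OF sales, of "\<lambda>m i. y (Alpha m i)"]
    unfolding dual_value_def by linarith
  also have "\<dots> = (\<Sum>\<sigma>\<in>rankings n.
      l \<sigma> * (y Beta + (\<Sum>m\<in>{1..M}. y (Alpha m (favourite \<sigma> (Ss m))))))"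
    using l_dist(2)
    by (simp add: demand_sum distrib_left sum.distrib flip: sum_distrib_right)
  also have "\<dots> \<le> (\<Sum>\<sigma>\<in>rankings n. l \<sigma> * r (favourite \<sigma> S))"
    using bound l_dist(1) unfolding ranking_bound_def
    by (intro sum_mono mult_left_mono) auto
  also have "\<dots> = revenue n r l S" using revenue_favourite[OF S] by simp
  finally show ?thesis .
qed

text \<open>Strong duality with attainment.  If no dual point reaches the value \<open>V\<close>, Farkas' lemma gives
  multipliers of the dual constraints.  Those of the rankings, divided by the multiplier \<open>\<mu>\<close> of the
  objective, form a distribution in the uncertainty set with revenue below \<open>V\<close>.\<close>

lemma dual_certificate_exists:
  assumes sales: "valid_sales n M Ss v" and S: "S \<in> assortments n"
    and V: "\<And>l. l \<in> uncertainty_set nk n M Ss v \<eta> \<Longrightarrow> V \<le> revenue n r l S"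
  shows "\<exists>y. dominates_dual_norm nk y \<and> ranking_bound r S y \<and> V \<le> dual_value v \<eta> y"
proof (rule ccontr)
  assume none: "\<not> ?thesis"
  \<comment> \<open>the constraints on \<open>Theta\<close>: one per observation or a single one, under a dummy index\<close>
  define N where "N = (case nk of L1 \<Rightarrow> observations | Linf \<Rightarrow> {(0, 0)})"
  define aR where "aR = (\<lambda>\<sigma> (y :: dual_var \<Rightarrow> real).
    y Beta + (\<Sum>m\<in>{1..M}. y (Alpha m (favourite \<sigma> (Ss m)))))"
  define aP where "aP = (\<lambda>(m, i) (y :: dual_var \<Rightarrow> real). y (Alpha m i) - y (Tau m i))"
  define aN where "aN = (\<lambda>(m, i) (y :: dual_var \<Rightarrow> real). - y (Alpha m i) - y (Tau m i))"
  define aT where "aT = (\<lambda>(m, i) (y :: dual_var \<Rightarrow> real). case nk of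
      L1 \<Rightarrow> y (Tau m i) - y Theta
    | Linf \<Rightarrow> (\<Sum>(m, i)\<in>observations. y (Tau m i)) - y Theta)"
  define aO where "aO = (\<lambda>(_ :: unit) (y :: dual_var \<Rightarrow> real). - dual_value v \<eta> y)"
  define K where
    "K = rankings n <+> (observations <+> (observations <+> (N <+> {()})))"
  define a where "a = case_sum aR (case_sum aP (case_sum aN (case_sum aT aO)))"
  define b where "b = case_sum (\<lambda>\<sigma>. r (favourite \<sigma> S))
    (case_sum (\<lambda>_ :: nat \<times> nat. 0) (case_sum (\<lambda>_ :: nat \<times> nat. 0)
      (case_sum (\<lambda>_ :: nat \<times> nat. 0) (\<lambda>_ :: unit. - V))))"
  note forms = aR_def aP_def aN_def aT_def aO_def
  have K_mem: "Inl \<sigma> \<in> K \<longleftrightarrow> \<sigma> \<in> rankings n"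
    "Inr (Inl q) \<in> K \<longleftrightarrow> q \<in> observations" "Inr (Inr (Inl q)) \<in> K \<longleftrightarrow> q \<in> observations"
    "Inr (Inr (Inr (Inl q))) \<in> K \<longleftrightarrow> q \<in> N" "Inr (Inr (Inr (Inr ()))) \<in> K" for \<sigma> q
    unfolding K_def by auto
  have finN: "finite N"
    unfolding N_def using finite_observations by (simp split: norm_kind.split)
  have fin: "finite K"
    unfolding K_def by (intro finite_Plus finite_rankings finite_observations finN) simp
  have "lin_form (aR \<sigma>)" "lin_form (aP q)" "lin_form (aN q)" "lin_form (aT q)" "lin_form (aO ())"
    for \<sigma> q
    unfolding lin_form_def forms dual_value_def
    by (auto simp: algebra_simps sum.distrib sum_distrib_left case_prod_unfold
        split: norm_kind.split)
  then have lin: "\<forall>k\<in>K. lin_form (a k)"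
    unfolding K_def a_def by (auto split: sum.split)
  have "\<not> (\<exists>y. \<forall>k\<in>K. a k y \<le> b k)"
  proof
    assume "\<exists>y. \<forall>k\<in>K. a k y \<le> b k"
    then obtain y where y: "\<forall>k\<in>K. a k y \<le> b k" by blast
    have R: "aR \<sigma> y \<le> r (favourite \<sigma> S)" if "\<sigma> \<in> rankings n" for \<sigma>
      using bspec[OF y, of "Inl \<sigma>"] that K_mem unfolding a_def b_def by simp
    have P: "aP q y \<le> 0" if "q \<in> observations" for q
      using bspec[OF y, of "Inr (Inl q)"] that K_mem unfolding a_def b_def by simp
    have N: "aN q y \<le> 0" if "q \<in> observations" for q
      using bspec[OF y, of "Inr (Inr (Inl q))"] that K_mem unfolding a_def b_def by simp
    have T: "aT q y \<le> 0" if "q \<in> N" for q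
      using bspec[OF y, of "Inr (Inr (Inr (Inl q)))"] that K_mem unfolding a_def b_def by simp
    have O: "aO () y \<le> - V"
      using bspec[OF y, of "Inr (Inr (Inr (Inr ())))"] K_mem unfolding a_def b_def by simp
    have "ranking_bound r S y" using R unfolding ranking_bound_def aR_def by simp
    moreover have "dominates_dual_norm nk y"
      using P N T unfolding dominates_dual_norm_def aP_def aN_def aT_def N_def
      by (cases nk) (fastforce simp: abs_le_iff)+
    moreover have "V \<le> dual_value v \<eta> y" using O unfolding aO_def by simp
    ultimately show False using none by blast
  qed
  then obtain u where u: "\<forall>k\<in>K. 0 \<le> u k" "\<And>y. (\<Sum>k\<in>K. u k * a k y) = 0"
    "(\<Sum>k\<in>K. u k * b k) < 0"
    using farkas_affine[OF fin lin] by blast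
  define lam where "lam = (\<lambda>\<sigma>. u (Inl \<sigma>))"
  define up where "up = (\<lambda>q. u (Inr (Inl q)))"
  define un where "un = (\<lambda>q. u (Inr (Inr (Inl q))))"
  define w where "w = (\<lambda>q. u (Inr (Inr (Inr (Inl q)))))"
  define \<mu> where "\<mu> = u (Inr (Inr (Inr (Inr ()))))"
  note u_defs = lam_def up_def un_def w_def \<mu>_def
  have lam0: "0 \<le> lam \<sigma>" if "\<sigma> \<in> rankings n" for \<sigma> using u(1) that K_mem unfolding lam_def by simp
  have up0: "0 \<le> up q" and un0: "0 \<le> un q" if "q \<in> observations" for q
    using u(1) that K_mem unfolding up_def un_def by simp_all
  have \<mu>0: "0 \<le> \<mu>" using u(1) K_mem unfolding \<mu>_def by simp
  have zero: "(\<Sum>\<sigma>\<in>rankings n. lam \<sigma> * aR \<sigma> y) + (\<Sum>q\<in>observations. up q * aP q y)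
      + (\<Sum>q\<in>observations. un q * aN q y) + (\<Sum>q\<in>N. w q * aT q y) = \<mu> * dual_value v \<eta> y" for y
    using u(2)[of y] finite_rankings[of n] finite_observations finN
    unfolding K_def a_def u_defs aO_def by (simp add: sum.Plus)
  have neg: "(\<Sum>\<sigma>\<in>rankings n. lam \<sigma> * r (favourite \<sigma> S)) < \<mu> * V"
    using u(3) finite_rankings[of n] finite_observations finN
    unfolding K_def b_def u_defs by (simp add: sum.Plus)
  \<comment> \<open>evaluating \<open>zero\<close> at the unit vector of each variable recovers the primal constraints\<close>
  have total: "(\<Sum>\<sigma>\<in>rankings n. lam \<sigma>) = \<mu>"
    using zero[of "\<lambda>z. of_bool (z = Beta)"]
    unfolding forms dual_value_def by (cases nk) (simp_all add: case_prod_unfold)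
  have alpha: "demand n lam (Ss m) i + up (m, i) - un (m, i) = \<mu> * v m i"
    if mi: "(m, i) \<in> observations" for m i
  proof -
    let ?y = "\<lambda>z. of_bool (z = Alpha m i) :: real"
    have m: "m \<in> {1..M}" "i \<in> {0..n}"
      using mi subsetD[OF Ss_subset, of m i] unfolding observations_def by simp_all
    have "aR \<sigma> ?y = of_bool (i = favourite \<sigma> (Ss m))" for \<sigma>
    proof -
      have eq: "(\<Sum>m'\<in>{1..M}. ?y (Alpha m' (favourite \<sigma> (Ss m'))))
          = (\<Sum>m'\<in>{1..M}. if m' = m then of_bool (i = favourite \<sigma> (Ss m)) else 0)"
        by (rule sum.cong) auto
      show ?thesis unfolding aR_def eq using m by simp
    qed
    then have "(\<Sum>\<sigma>\<in>rankings n. lam \<sigma> * aR \<sigma> ?y) = demand n lam (Ss m) i"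
      using m Ss_nonempty by (simp add: demand_favourite mult.commute)
    moreover have "(\<Sum>q\<in>observations. up q * aP q ?y) = up (m, i)"
    proof -
      have "up q * aP q ?y = (if q = (m, i) then up q else 0)" for q
        unfolding aP_def by (cases q) auto
      then show ?thesis using mi finite_observations by simp
    qed
    moreover have "(\<Sum>q\<in>observations. un q * aN q ?y) = - un (m, i)"
    proof -
      have "un q * aN q ?y = (if q = (m, i) then - un q else 0)" for q
        unfolding aN_def by (cases q) auto
      then show ?thesis using mi finite_observations by simp
    qed
    moreover have "aT q ?y = 0" for q
      unfolding aT_def by (cases nk) (simp_all add: case_prod_unfold)
    moreover have "dual_value v \<eta> ?y = v m i"
    proof -
      have "(\<Sum>i'\<in>{0..n}. v m' i' * ?y (Alpha m' i')) = (if m' = m then v m' i else 0)" for m'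
      proof -
        have "v m' i' * ?y (Alpha m' i') = (if i' = i then if m' = m then v m' i else 0 else 0)"
          for i' by auto
        then show ?thesis using m by simp
      qed
      then show ?thesis using m unfolding dual_value_def by simp
    qed
    ultimately show ?thesis using zero[of ?y] by simp
  qed
  have tau: "(case nk of L1 \<Rightarrow> w (m, i) | Linf \<Rightarrow> w (0, 0)) = up (m, i) + un (m, i)"
    if mi: "(m, i) \<in> observations" for m i
  proof -
    let ?y = "\<lambda>z. of_bool (z = Tau m i) :: real"
    have "aR \<sigma> ?y = 0" for \<sigma> unfolding aR_def by simp
    moreover have "(\<Sum>q\<in>observations. up q * aP q ?y) = - up (m, i)"
    proof -
      have "up q * aP q ?y = (if q = (m, i) then - up q else 0)" for q
        unfolding aP_def by (cases q) auto
      then show ?thesis using mi finite_observations by simp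
    qed
    moreover have "(\<Sum>q\<in>observations. un q * aN q ?y) = - un (m, i)"
    proof -
      have "un q * aN q ?y = (if q = (m, i) then - un q else 0)" for q
        unfolding aN_def by (cases q) auto
      then show ?thesis using mi finite_observations by simp
    qed
    moreover have "(\<Sum>q\<in>N. w q * aT q ?y) = (case nk of L1 \<Rightarrow> w (m, i) | Linf \<Rightarrow> w (0, 0))"
    proof (cases nk)
      case L1
      have "w q * aT q ?y = (if q = (m, i) then w q else 0)" for q
        unfolding aT_def L1 by (cases q) auto
      then show ?thesis using mi finite_observations L1 unfolding N_def by simp
    next
      case Linf
      have "(\<Sum>(m', i')\<in>observations. of_bool (m' = m \<and> i' = i) :: real)
          = (\<Sum>q\<in>observations. if q = (m, i) then 1 else 0)"
        by (rule sum.cong) auto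
      also have "\<dots> = 1" using mi finite_observations by simp
      finally show ?thesis using Linf unfolding N_def aT_def by simp
    qed
    moreover have "dual_value v \<eta> ?y = 0" unfolding dual_value_def by simp
    ultimately show ?thesis using zero[of ?y] by simp
  qed
  have theta: "(\<Sum>q\<in>N. w q) = \<mu> * \<eta>"
    using zero[of "\<lambda>z. of_bool (z = Theta)"]
    unfolding forms dual_value_def
    by (cases nk) (simp_all add: case_prod_unfold sum_negf)
  have "\<mu> \<noteq> 0"
  proof
    assume "\<mu> = 0"
    then have "lam \<sigma> = 0" if "\<sigma> \<in> rankings n" for \<sigma>
      using total lam0 that finite_rankings by (simp add: sum_nonneg_eq_0_iff)
    then show False using neg \<open>\<mu> = 0\<close> by simp
  qed
  then have \<mu>: "\<mu> > 0" using \<mu>0 by simp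
  define l where "l = (\<lambda>\<sigma>. inverse \<mu> * lam \<sigma>)"
  define e where "e = (\<lambda>m i. demand n l (Ss m) i - v m i)"
  have e_le: "\<bar>e m i\<bar> \<le> inverse \<mu> * (case nk of L1 \<Rightarrow> w (m, i) | Linf \<Rightarrow> w (0, 0))"
    if mi: "(m, i) \<in> observations" for m i
  proof -
    have "demand n l (Ss m) i = inverse \<mu> * demand n lam (Ss m) i"
      unfolding demand_def l_def by (simp add: sum_distrib_left mult.left_commute)
    then have "e m i = inverse \<mu> * (un (m, i) - up (m, i))"
      using alpha[OF mi] \<mu> unfolding e_def by (simp add: field_simps)
    then have "\<bar>e m i\<bar> = inverse \<mu> * \<bar>un (m, i) - up (m, i)\<bar>"
      using \<mu> by (simp add: abs_mult)
    also have "\<dots> \<le> inverse \<mu> * (up (m, i) + un (m, i))"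
      using \<mu> up0[OF mi] un0[OF mi] by (intro mult_left_mono) auto
    finally show ?thesis using tau[OF mi] by simp
  qed
  have "vec_norm nk M Ss e \<le> \<eta>"
  proof (cases nk)
    case L1
    have "vec_norm nk M Ss e = (\<Sum>(m, i)\<in>observations. \<bar>e m i\<bar>)"
      using L1 unfolding observations_def by simp
    also have "\<dots> \<le> (\<Sum>q\<in>observations. inverse \<mu> * w q)"
      using e_le L1 by (intro sum_mono) auto
    also have "\<dots> = \<eta>"
      using theta \<mu> L1 unfolding N_def by (simp add: sum_distrib_left[symmetric])
    finally show ?thesis .
  next
    case Linf
    then have "\<bar>e m i\<bar> \<le> \<eta>" if "(m, i) \<in> observations" for m i
      using e_le[OF that] theta \<mu> Linf unfolding N_def by (simp add: field_simps)
    then show ?thesis unfolding Linf vec_norm_Linf_le_iff by blast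
  qed
  moreover have "l \<in> ranking_dists n"
    using lam0 total \<mu> unfolding ranking_dists_def l_def
    by (simp add: sum_distrib_left[symmetric])
  ultimately have "l \<in> uncertainty_set nk n M Ss v \<eta>"
    unfolding uncertainty_set_def e_def by blast
  moreover have "revenue n r l S = inverse \<mu> * (\<Sum>\<sigma>\<in>rankings n. lam \<sigma> * r (favourite \<sigma> S))"
    unfolding revenue_favourite[OF S] l_def by (simp add: sum_distrib_left mult.assoc)
  ultimately have "\<mu> * V \<le> (\<Sum>\<sigma>\<in>rankings n. lam \<sigma> * r (favourite \<sigma> S))"
    using mult_left_mono[OF V[of l], of \<mu>] \<mu> by (simp add: mult.assoc[symmetric])
  then show False using neg by simp
qed

end

section \<open>Path potentials\<close>

context nested_history
begin

text \<open>If \<open>j\<close> is available in \<open>Ss m\<close> and \<open>i\<close> is chosen there instead, then \<open>i\<close> is preferred to \<open>j\<close>, and a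
  customer on this path cannot buy \<open>j\<close> as soon as \<open>i\<close> is offered too.\<close>

definition blocks :: "nat \<Rightarrow> nat \<Rightarrow> nat \<Rightarrow> int" where
  "blocks j m i = of_bool (j \<in> Ss m \<and> i \<noteq> j)"

text \<open>The weight of the node \<open>i\<close> in layer \<open>m\<close>, with the largest revenue \<open>r n\<close> as a big-M penalty for
  paths that are incompatible with the purchase of \<open>j\<close> from \<open>S\<close>.\<close>

definition step_gain ::
  "(nat \<Rightarrow> real) \<Rightarrow> nat set \<Rightarrow> (dual_var \<Rightarrow> real) \<Rightarrow> nat \<Rightarrow> nat \<Rightarrow> nat \<Rightarrow> real" where
  "step_gain r S y j m i = y (Alpha m i) - of_int (blocks j m i) * r n * of_bool (i \<in> S)"

text \<open>\<open>Pot j m i\<close> is an upper bound for the weight of every purchase path that ends with the choice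
  \<open>i\<close> from \<open>Ss m\<close>.  For every target \<open>j\<close> these polynomially many constraints replace the bounds for all
  rankings whose favourite in \<open>S\<close> is \<open>j\<close>.\<close>

definition path_bound :: "(nat \<Rightarrow> real) \<Rightarrow> nat set \<Rightarrow> (dual_var \<Rightarrow> real) \<Rightarrow> bool" where
  "path_bound r S y \<longleftrightarrow> (\<forall>j\<in>{0..n}.
     (\<forall>i\<in>Ss 1. y Beta + step_gain r S y j 1 i \<le> y (Pot j 1 i)) \<and>
     (\<forall>m\<in>{1..<M}. \<forall>k\<in>Ss m. \<forall>i\<in>Ss (Suc m). (i \<in> Ss m \<longrightarrow> i = k) \<longrightarrow>
        y (Pot j m k) + step_gain r S y j (Suc m) i \<le> y (Pot j (Suc m) i)) \<and>
     (\<forall>i\<in>Ss M. y (Pot j M i) \<le> r j + r n * of_bool (j \<notin> S)))"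

lemma path_potential:
  assumes y: "path_bound r S y" and j: "j \<le> n" and p: "purchase_path M p" and m: "m \<in> {1..M}"
  shows "y Beta + (\<Sum>k\<in>{1..m}. step_gain r S y j k (p k)) \<le> y (Pot j m (p m))"
proof -
  have "1 \<le> m" "m \<le> M" using m by auto
  then show ?thesis
  proof (induction m rule: dec_induct)
    case base
    then show ?case using y j p M_pos unfolding path_bound_def purchase_path_def by auto
  next
    case (step m)
    have "p m \<in> Ss m" "p (Suc m) \<in> Ss (Suc m)" "p (Suc m) \<in> Ss m \<longrightarrow> p (Suc m) = p m"
      using p step unfolding purchase_path_def by auto
    then have "y (Pot j m (p m)) + step_gain r S y j (Suc m) (p (Suc m))
        \<le> y (Pot j (Suc m) (p (Suc m)))"
      using y j step unfolding path_bound_def by auto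
    then show ?case using step by simp
  qed
qed

lemma ranking_path:
  "purchase_path M (\<lambda>m. favourite \<sigma> (Ss m))" if "\<sigma> \<in> rankings n"
  unfolding purchase_path_def
proof (intro conjI ballI impI)
  show "favourite \<sigma> (Ss m) \<in> Ss m" if "m \<in> {1..M}" for m
    using favourite_in Ss_nonempty that by blast
next
  fix m assume m: "m \<in> {1..<M}" and stay: "favourite \<sigma> (Ss (Suc m)) \<in> Ss m"
  have sub: "Ss m \<subseteq> Ss (Suc m)" using Ss_mono[of m "Suc m"] m by auto
  have "is_arg_min \<sigma> (\<lambda>j. j \<in> Ss m) (favourite \<sigma> (Ss (Suc m)))"
    using stay sub favourite_le[of _ "Ss (Suc m)" \<sigma>] unfolding is_arg_min_linorder by blast
  then show "favourite \<sigma> (Ss (Suc m)) = favourite \<sigma> (Ss m)"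
    using is_arg_min_iff_favourite[OF inj_ranking[OF that], of "Ss m"] stay by auto
qed

text \<open>The path of a ranking whose favourite in \<open>S\<close> is \<open>j\<close> carries no penalty: if \<open>j\<close> is available and
  the ranking chooses an offered product, both choices compare the same two products.\<close>

lemma path_bound_imp_ranking_bound:
  assumes y: "path_bound r S y" and S: "S \<in> assortments n"
  shows "ranking_bound r S y"
  unfolding ranking_bound_def
proof
  fix \<sigma> assume \<sigma>: "\<sigma> \<in> rankings n"
  define p where "p = (\<lambda>m. favourite \<sigma> (Ss m))"
  define j where "j = favourite \<sigma> S"
  have jS: "j \<in> S" unfolding j_def using favourite_in S unfolding assortments_def by blast
  have jn: "j \<le> n" using jS S unfolding assortments_def by auto
  have p: "purchase_path M p" unfolding p_def by (rule ranking_path[OF \<sigma>])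
  have gain: "step_gain r S y j m (p m) = y (Alpha m (p m))" for m
  proof (cases "j \<in> Ss m \<and> p m \<in> S")
    case True
    have "\<sigma> j \<le> \<sigma> (p m)" "\<sigma> (p m) \<le> \<sigma> j"
      using True favourite_le[of "p m" S \<sigma>] favourite_le[of j "Ss m" \<sigma>]
      unfolding p_def j_def by auto
    then have "p m = j" using inj_ranking[OF \<sigma>] by (simp add: inj_eq)
    then show ?thesis unfolding step_gain_def blocks_def by simp
  next
    case False
    then show ?thesis unfolding step_gain_def blocks_def by auto
  qed
  have "y Beta + (\<Sum>m\<in>{1..M}. y (Alpha m (p m))) \<le> y (Pot j M (p M))"
    using path_potential[OF y jn p, of M] M_pos gain by simp
  moreover have "p M \<in> Ss M" using p M_pos unfolding purchase_path_def by simp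
  then have "y (Pot j M (p M)) \<le> r j + r n * of_bool (j \<notin> S)"
    using y jn unfolding path_bound_def by simp
  ultimately show "y Beta + (\<Sum>m\<in>{1..M}. y (Alpha m (favourite \<sigma> (Ss m)))) \<le> r (favourite \<sigma> S)"
    using jS unfolding p_def j_def by simp
qed

lemma revenue_bounds:
  assumes "valid_revenues n r" "i \<le> n"
  shows "0 \<le> r i" "r i \<le> r n"
proof -
  have "r i \<le> r k" if "i \<le> k" "k \<le> n" for i k
    using assms(1) that unfolding valid_revenues_def strict_mono_on_def
    by (cases "i = k") (auto intro: less_imp_le)
  from this[of 0 i] this[of i n] show "0 \<le> r i" "r i \<le> r n"
    using assms unfolding valid_revenues_def by auto
qed

text \<open>The penalty \<open>r n\<close> is large enough.  For \<open>j \<in> S\<close>, a path without a penalty is realised by a ranking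
  that buys \<open>j\<close> from \<open>S\<close>, and the bound is that of this ranking.  Every other path is still realised by
  some ranking, so that its unpenalised weight is at most \<open>r n\<close>, and a single penalty, or the slack
  \<open>r n\<close> for \<open>j \<notin> S\<close>, pays for it.\<close>

lemma penalised_path_le:
  assumes r: "valid_revenues n r" and S: "S \<in> assortments n" and y: "ranking_bound r S y"
    and j: "j \<le> n" and p: "purchase_path M p"
  shows "y Beta + (\<Sum>m\<in>{1..M}. step_gain r S y j m (p m)) \<le> r j + r n * of_bool (j \<notin> S)"
proof (cases "j \<in> S \<and> (\<forall>m\<in>{1..M}. j \<in> Ss m \<longrightarrow> p m \<in> S \<longrightarrow> p m = j)")
  case True
  obtain \<sigma> where \<sigma>: "\<sigma> \<in> rankings n" "\<And>m. m \<in> {1..M} \<Longrightarrow> favourite \<sigma> (Ss m) = p m"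
    "favourite \<sigma> S = j"
    using purchase_path_realizable[OF p, of S j] True S unfolding assortments_def by blast
  have "(\<Sum>m\<in>{1..M}. step_gain r S y j m (p m))
      = (\<Sum>m\<in>{1..M}. y (Alpha m (favourite \<sigma> (Ss m))))"
    using True by (intro sum.cong) (auto simp: step_gain_def blocks_def \<sigma>(2))
  then show ?thesis using y \<sigma>(1,3) True unfolding ranking_bound_def by auto
next
  case False
  have 0: "0 \<in> {0..n}" by simp
  obtain \<sigma> where \<sigma>: "\<sigma> \<in> rankings n" "\<And>m. m \<in> {1..M} \<Longrightarrow> favourite \<sigma> (Ss m) = p m"
    using purchase_path_realizable[OF p, of "{0}" 0] by auto
  have "favourite \<sigma> S \<le> n"
    using favourite_in[of S \<sigma>] S unfolding assortments_def by force
  then have "r (favourite \<sigma> S) \<le> r n" using revenue_bounds[OF r] by blast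
  then have total: "y Beta + (\<Sum>m\<in>{1..M}. y (Alpha m (p m))) \<le> r n"
    using y \<sigma> unfolding ranking_bound_def by fastforce
  define c where "c = (\<lambda>m. of_int (blocks j m (p m)) * r n * of_bool (p m \<in> S))"
  have rn: "0 \<le> r n" using revenue_bounds[OF r] by blast
  have c0: "0 \<le> c m" for m unfolding c_def blocks_def using rn by simp
  have split: "(\<Sum>m\<in>{1..M}. step_gain r S y j m (p m))
      = (\<Sum>m\<in>{1..M}. y (Alpha m (p m))) - (\<Sum>m\<in>{1..M}. c m)"
    unfolding step_gain_def c_def by (simp add: sum_subtractf)
  have csum: "0 \<le> (\<Sum>m\<in>{1..M}. c m)" using c0 by (intro sum_nonneg)
  have rj: "0 \<le> r j" using revenue_bounds[OF r j] by blast
  show ?thesis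
  proof (cases "j \<in> S")
    case False
    then show ?thesis using total split csum rj by simp
  next
    case True
    then obtain m where m: "m \<in> {1..M}" "j \<in> Ss m" "p m \<in> S" "p m \<noteq> j" using False by blast
    then have "c m = r n" unfolding c_def blocks_def by simp
    moreover have "c m \<le> (\<Sum>m\<in>{1..M}. c m)"
      using m(1) c0 by (intro member_le_sum) auto
    ultimately show ?thesis using total split rj True by simp
  qed
qed

text \<open>The longest-path value satisfies the step inequalities, and in the last layer it is attained
  by a path; the latter turns bounds on single paths into bounds on the potential.\<close>

lemma longest_path_potential:
  fixes b :: real and g :: "nat \<Rightarrow> nat \<Rightarrow> real"
  obtains \<pi> where "\<And>i. i \<in> Ss 1 \<Longrightarrow> b + g 1 i \<le> \<pi> 1 i"
    "\<And>m k i. \<lbrakk>m \<in> {1..<M}; k \<in> Ss m; i \<in> Ss (Suc m); i \<in> Ss m \<longrightarrow> i = k\<rbrakk>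
      \<Longrightarrow> \<pi> m k + g (Suc m) i \<le> \<pi> (Suc m) i"
    "\<And>i. i \<in> Ss M \<Longrightarrow> \<exists>p. purchase_path M p \<and> \<pi> M i = b + (\<Sum>k\<in>{1..M}. g k (p k))"
proof -
  define A where "A = (\<lambda>m i. {p. purchase_path m p \<and> p m = i})"
  define len where "len = (\<lambda>m (p :: nat \<Rightarrow> nat). b + (\<Sum>k\<in>{1..m}. g k (p k)))"
  define \<pi> where "\<pi> = (\<lambda>m i. Max (len m ` A m i))"
  have nonempty: "A m i \<noteq> {}" if m: "m \<in> {1..M}" and i: "i \<in> Ss m" for m i
  proof -
    \<comment> \<open>choose the no-purchase option until \<open>i\<close> becomes available\<close>
    define p where "p = (\<lambda>k. if i \<in> Ss k then i else 0)"
    have "p (Suc k) = p k" if k: "k \<in> {1..<m}" "p (Suc k) \<in> Ss k" for k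
      using Ss_mono[of k "Suc k"] k m unfolding p_def by auto
    moreover have "p k \<in> Ss k" if "k \<in> {1..m}" for k
      using no_purchase m that unfolding p_def assortments_def by auto
    moreover have "p m = i" using i unfolding p_def by simp
    ultimately have "p \<in> A m i" unfolding A_def purchase_path_def by blast
    then show ?thesis by blast
  qed
  have fin: "finite (len m ` A m i)" if m: "m \<in> {1..M}" for m i
  proof -
    let ?F = "{1..m} \<rightarrow>\<^sub>E {0..n}"
    have "len m ` A m i \<subseteq> len m ` ?F"
    proof
      fix x assume "x \<in> len m ` A m i"
      then obtain p where p: "p \<in> A m i" "x = len m p" by blast
      have "p k \<in> {0..n}" if "k \<in> {1..m}" for k
        using p(1) that m subsetD[OF Ss_subset, of k "p k"]
        unfolding A_def purchase_path_def by auto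
      then have "restrict p {1..m} \<in> ?F" by auto
      moreover have "x = len m (restrict p {1..m})" unfolding p(2) len_def by simp
      ultimately show "x \<in> len m ` ?F" by blast
    qed
    then show ?thesis by (rule finite_subset) (simp add: finite_PiE)
  qed
  show thesis
  proof (rule that[of \<pi>])
    fix i assume i: "i \<in> Ss 1"
    then have "(\<lambda>_. i) \<in> A 1 i" unfolding A_def purchase_path_def by auto
    then have "len 1 (\<lambda>_. i) \<le> \<pi> 1 i"
      unfolding \<pi>_def using fin[of 1 i] M_pos by (intro Max_ge) auto
    then show "b + g 1 i \<le> \<pi> 1 i" unfolding len_def by simp
  next
    fix m k i
    assume m: "m \<in> {1..<M}" and k: "k \<in> Ss m" and i: "i \<in> Ss (Suc m)" "i \<in> Ss m \<longrightarrow> i = k"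
    have "\<pi> m k \<in> len m ` A m k"
      unfolding \<pi>_def using fin[of m k] nonempty[of m k] m k by (intro Max_in) auto
    then obtain p where p: "p \<in> A m k" "\<pi> m k = len m p" by blast
    define q where "q = p(Suc m := i)"
    have "q \<in> A (Suc m) i"
      using p(1) i unfolding A_def purchase_path_def q_def by (auto simp: le_Suc_eq less_Suc_eq)
    then have "len (Suc m) q \<le> \<pi> (Suc m) i"
      unfolding \<pi>_def using fin[of "Suc m" i] m by (intro Max_ge) auto
    moreover have "len (Suc m) q = len m p + g (Suc m) i"
    proof -
      have "(\<Sum>k\<in>{1..m}. g k (q k)) = (\<Sum>k\<in>{1..m}. g k (p k))"
        unfolding q_def by (intro sum.cong) auto
      then show ?thesis unfolding len_def by (simp add: q_def)
    qed
    ultimately show "\<pi> m k + g (Suc m) i \<le> \<pi> (Suc m) i" using p(2) by simp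
  next
    fix i assume i: "i \<in> Ss M"
    have "\<pi> M i \<in> len M ` A M i"
      unfolding \<pi>_def using fin[of M i] nonempty[of M i] M_pos i by (intro Max_in) auto
    then show "\<exists>p. purchase_path M p \<and> \<pi> M i = b + (\<Sum>k\<in>{1..M}. g k (p k))"
      unfolding A_def len_def by auto
  qed
qed

lemma ranking_bound_imp_path_bound:
  assumes r: "valid_revenues n r" and S: "S \<in> assortments n" and y: "ranking_bound r S y"
  obtains y' where "path_bound r S y'"
    "\<And>z. (\<forall>j m i. z \<noteq> Pot j m i) \<Longrightarrow> y' z = y z"
proof -
  define longest where "longest = (\<lambda>j \<pi>.
     (\<forall>i\<in>Ss 1. y Beta + step_gain r S y j 1 i \<le> \<pi> 1 i) \<and>
     (\<forall>m\<in>{1..<M}. \<forall>k\<in>Ss m. \<forall>i\<in>Ss (Suc m). (i \<in> Ss m \<longrightarrow> i = k) \<longrightarrow>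
        \<pi> m k + step_gain r S y j (Suc m) i \<le> \<pi> (Suc m) i) \<and>
     (\<forall>i\<in>Ss M. \<exists>p. purchase_path M p \<and>
        \<pi> M i = y Beta + (\<Sum>k\<in>{1..M}. step_gain r S y j k (p k))))"
  have "\<exists>\<pi>. longest j \<pi>" for j
  proof (rule longest_path_potential[of "y Beta" "step_gain r S y j"])
    fix \<pi> :: "nat \<Rightarrow> nat \<Rightarrow> real"
    assume "\<And>i. i \<in> Ss 1 \<Longrightarrow> y Beta + step_gain r S y j 1 i \<le> \<pi> 1 i"
      "\<And>m k i. \<lbrakk>m \<in> {1..<M}; k \<in> Ss m; i \<in> Ss (Suc m); i \<in> Ss m \<longrightarrow> i = k\<rbrakk>
        \<Longrightarrow> \<pi> m k + step_gain r S y j (Suc m) i \<le> \<pi> (Suc m) i"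
      "\<And>i. i \<in> Ss M \<Longrightarrow> \<exists>p. purchase_path M p \<and>
        \<pi> M i = y Beta + (\<Sum>k\<in>{1..M}. step_gain r S y j k (p k))"
    then have "longest j \<pi>" unfolding longest_def by (intro conjI ballI impI) simp_all
    then show ?thesis by (rule exI[of _ \<pi>])
  qed
  then obtain \<pi> where "longest j (\<pi> j)" for j using choice[of longest] by blast
  then have \<pi>: "\<And>j i. i \<in> Ss 1 \<Longrightarrow> y Beta + step_gain r S y j 1 i \<le> \<pi> j 1 i"
    "\<And>j m k i. \<lbrakk>m \<in> {1..<M}; k \<in> Ss m; i \<in> Ss (Suc m); i \<in> Ss m \<longrightarrow> i = k\<rbrakk> \<Longrightarrow>
        \<pi> j m k + step_gain r S y j (Suc m) i \<le> \<pi> j (Suc m) i"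
    "\<And>j i. i \<in> Ss M \<Longrightarrow> \<exists>p. purchase_path M p \<and>
        \<pi> j M i = y Beta + (\<Sum>k\<in>{1..M}. step_gain r S y j k (p k))"
    unfolding longest_def by blast+
  define y' where "y' = (\<lambda>z. case z of Pot j m i \<Rightarrow> \<pi> j m i | _ \<Rightarrow> y z)"
  have gain: "step_gain r S y' j m i = step_gain r S y j m i" for j m i
    unfolding step_gain_def y'_def by simp
  have "\<pi> j M i \<le> r j + r n * of_bool (j \<notin> S)" if "j \<in> {0..n}" "i \<in> Ss M" for j i
    using \<pi>(3)[OF that(2), of j] penalised_path_le[OF r S y, of j] that(1) by auto
  then have "path_bound r S y'"
    using \<pi>(1,2) unfolding path_bound_def gain by (simp add: y'_def)
  moreover have "y' z = y z" if "\<forall>j m i. z \<noteq> Pot j m i" for z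
    using that unfolding y'_def by (cases z) auto
  ultimately show thesis using that by blast
qed

end

section \<open>A sufficient criterion for reformulations\<close>

lemma finite_assortments: "finite (assortments n)"
  unfolding assortments_def by (rule finite_subset[of _ "Pow {0..n}"]) auto

lemma decode_in_assortments: "decode n x \<in> assortments n"
  unfolding decode_def assortments_def by auto

lemma decode_of_bool:
  assumes "S \<in> assortments n"
  shows "decode n (\<lambda>i. of_bool (i \<in> S)) = S"
proof -
  have "S \<subseteq> {0..n}" "0 \<in> S" using assms unfolding assortments_def by auto
  moreover have "i \<in> {1..n}" if "i \<in> S" "i \<noteq> 0" for i
    using subsetD[OF \<open>S \<subseteq> {0..n}\<close> that(1)] that(2) by auto
  ultimately show ?thesis unfolding decode_def by auto
qed

text \<open>Soundness bounds every objective value by the worst-case revenue of the decoded assortment, and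
  completeness attains this bound for each assortment.  Hence the maximum over the finitely many
  assortments is the optimal value, and an optimal solution leaves no gap in the bound.\<close>

lemma reformulatesI:
  assumes bin: "n \<le> nbin P"
    and sound: "\<And>x y. milp_feasible P x y \<Longrightarrow>
      milp_objective P x y \<le> worst_case_revenue n r U (decode n x)"
    and complete: "\<And>S. S \<in> assortments n \<Longrightarrow>
      \<exists>x y. milp_feasible P x y \<and> decode n x = S \<and>
        worst_case_revenue n r U S \<le> milp_objective P x y"
  shows "reformulates P n r U"
proof -
  let ?W = "worst_case_revenue n r U"
  have le: "?W S \<le> robust_value n r U" if "S \<in> assortments n" for S
    unfolding robust_value_def using that finite_assortments by (intro Max_ge) auto
  have "robust_value n r U \<in> ?W ` assortments n"
    unfolding robust_value_def using finite_assortments decode_in_assortments[of n]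
    by (intro Max_in) auto
  then obtain S where S: "S \<in> assortments n" "robust_value n r U = ?W S" by blast
  obtain x y where xy: "milp_feasible P x y" "robust_value n r U \<le> milp_objective P x y"
    using complete[OF S(1)] S(2) by auto
  have upper: "milp_objective P x' y' \<le> robust_value n r U" if "milp_feasible P x' y'" for x' y'
    using sound[OF that] le[OF decode_in_assortments[of n x']] by simp
  have "milp_optimal P x y"
    unfolding milp_optimal_def using xy upper order_trans by blast
  moreover have "milp_objective P x' y' = robust_value n r U \<and>
      ?W (decode n x') = robust_value n r U" if opt: "milp_optimal P x' y'" for x' y'
  proof -
    have f: "milp_feasible P x' y'" and "milp_objective P x y \<le> milp_objective P x' y'"
      using opt xy(1) unfolding milp_optimal_def by auto
    then show ?thesis
      using xy(2) sound[OF f] le[OF decode_in_assortments[of n x']] by linarith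
  qed
  ultimately show ?thesis
    unfolding reformulates_def using bin decode_in_assortments by blast
qed

text \<open>Variables and rows with arbitrary finite index sets can be numbered.  The resulting problem does
  not depend on the evaluation \<open>E\<close> of its symbolic coefficients.\<close>

lemma milp_from_indexed_rows:
  fixes J :: "'j set" and K :: "'k set" and oc :: "'j \<Rightarrow> 'a"
  assumes finJ: "finite J" and finK: "finite K"
  obtains P where "nbin P = nb" "ncont P = card J" "ncon P = card K"
    "\<And>E x y. milp_feasible (map_milp E P) x y \<Longrightarrow> \<exists>y'.
       (\<forall>b\<in>{1..nb}. x b \<in> {0, 1}) \<and>
       (\<forall>k\<in>K. (\<Sum>b\<in>{1..nb}. E (rb k b) * x b) + (\<Sum>z\<in>J. E (rc k z) * y' z) \<le> E (rh k)) \<and>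
       milp_objective (map_milp E P) x y
         = (\<Sum>b\<in>{1..nb}. E (ob b) * x b) + (\<Sum>z\<in>J. E (oc z) * y' z)"
    "\<And>E x y'. (\<forall>b\<in>{1..nb}. x b \<in> {0, 1}) \<Longrightarrow>
       (\<forall>k\<in>K. (\<Sum>b\<in>{1..nb}. E (rb k b) * x b) + (\<Sum>z\<in>J. E (rc k z) * y' z) \<le> E (rh k)) \<Longrightarrow>
       \<exists>y. milp_feasible (map_milp E P) x y \<and> milp_objective (map_milp E P) x y
         = (\<Sum>b\<in>{1..nb}. E (ob b) * x b) + (\<Sum>z\<in>J. E (oc z) * y' z)"
proof -
  obtain gj where gj: "bij_betw gj {1..card J} J" using ex_bij_betw_nat_finite_1[OF finJ] by blast
  obtain gk where gk: "bij_betw gk {1..card K} K" using ex_bij_betw_nat_finite_1[OF finK] by blast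
  define P where "P = MILP nb (card J) (card K) ob (\<lambda>j. oc (gj j)) (\<lambda>k. rb (gk k))
    (\<lambda>k j. rc (gk k) (gj j)) (\<lambda>k. rh (gk k))"
  have cont: "(\<Sum>j\<in>{1..card J}. c (gj j) * y j) = (\<Sum>z\<in>J. c z * y' z)"
    if "\<forall>j\<in>{1..card J}. y j = y' (gj j)" for c y y' :: "_ \<Rightarrow> real"
  proof -
    have "(\<Sum>j\<in>{1..card J}. c (gj j) * y j) = (\<Sum>j\<in>{1..card J}. c (gj j) * y' (gj j))"
      using that by (intro sum.cong) auto
    then show ?thesis using sum.reindex_bij_betw[OF gj, of "\<lambda>z. c z * y' z"] by simp
  qed
  have feasible: "milp_feasible (map_milp E P) x y \<longleftrightarrow> (\<forall>b\<in>{1..nb}. x b \<in> {0, 1}) \<and>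
      (\<forall>k\<in>K. (\<Sum>b\<in>{1..nb}. E (rb k b) * x b) + (\<Sum>z\<in>J. E (rc k z) * y' z) \<le> E (rh k))"
    and objective: "milp_objective (map_milp E P) x y
      = (\<Sum>b\<in>{1..nb}. E (ob b) * x b) + (\<Sum>z\<in>J. E (oc z) * y' z)"
    if y: "\<forall>j\<in>{1..card J}. y j = y' (gj j)" for E x y y'
  proof -
    have K: "K = gk ` {1..card K}" using gk by (simp add: bij_betw_def)
    show "milp_feasible (map_milp E P) x y \<longleftrightarrow> (\<forall>b\<in>{1..nb}. x b \<in> {0, 1}) \<and>
      (\<forall>k\<in>K. (\<Sum>b\<in>{1..nb}. E (rb k b) * x b) + (\<Sum>z\<in>J. E (rc k z) * y' z) \<le> E (rh k))"
      unfolding milp_feasible_def P_def milp.map milp.sel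
      by (subst K) (simp only: o_def ball_simps cont[OF y, of "\<lambda>z. E (rc _ z)"])
    show "milp_objective (map_milp E P) x y
      = (\<Sum>b\<in>{1..nb}. E (ob b) * x b) + (\<Sum>z\<in>J. E (oc z) * y' z)"
      unfolding milp_objective_def P_def milp.map milp.sel
      by (simp only: o_def cont[OF y, of "\<lambda>z. E (oc z)"])
  qed
  show thesis
  proof (rule that[of P])
    show "nbin P = nb" "ncont P = card J" "ncon P = card K" unfolding P_def by simp_all
  next
    fix E x y assume f: "milp_feasible (map_milp E P) x y"
    let ?y = "\<lambda>z. y (inv_into {1..card J} gj z)"
    have y: "\<forall>j\<in>{1..card J}. y j = ?y (gj j)"
      using gj by (simp add: bij_betw_def)
    show "\<exists>y'. (\<forall>b\<in>{1..nb}. x b \<in> {0, 1}) \<and>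
       (\<forall>k\<in>K. (\<Sum>b\<in>{1..nb}. E (rb k b) * x b) + (\<Sum>z\<in>J. E (rc k z) * y' z) \<le> E (rh k)) \<and>
       milp_objective (map_milp E P) x y
         = (\<Sum>b\<in>{1..nb}. E (ob b) * x b) + (\<Sum>z\<in>J. E (oc z) * y' z)"
      using feasible[OF y, of E x] objective[OF y, of E x] f
      by (intro exI[of _ ?y]) (simp only: simp_thms)
  next
    fix E x and y' :: "'j \<Rightarrow> real"
    assume "\<forall>b\<in>{1..nb}. x b \<in> {0, 1 :: real}"
      "\<forall>k\<in>K. (\<Sum>b\<in>{1..nb}. E (rb k b) * x b) + (\<Sum>z\<in>J. E (rc k z) * y' z) \<le> E (rh k)"
    then show "\<exists>y. milp_feasible (map_milp E P) x y \<and> milp_objective (map_milp E P) x y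
         = (\<Sum>b\<in>{1..nb}. E (ob b) * x b) + (\<Sum>z\<in>J. E (oc z) * y' z)"
      using feasible[of "\<lambda>j. y' (gj j)" y' E x] objective[of "\<lambda>j. y' (gj j)" y' E x]
      by (intro exI[of _ "\<lambda>j. y' (gj j)"]) blast
  qed
qed

section \<open>The mixed-integer problem\<close>

definition integer_coeff :: "int \<Rightarrow> affine_coeff" where
  "integer_coeff c = Affine c (\<lambda>_. 0) (\<lambda>_ _. 0) 0"

definition revenue_coeff :: "nat \<Rightarrow> int \<Rightarrow> nat \<Rightarrow> int \<Rightarrow> affine_coeff" where
  "revenue_coeff i c j d = Affine 0 (\<lambda>k. c * of_bool (k = i) + d * of_bool (k = j)) (\<lambda>_ _. 0) 0"

definition dual_value_coeff :: "dual_var \<Rightarrow> affine_coeff" where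
  "dual_value_coeff z = Affine (of_bool (z = Beta)) (\<lambda>_. 0) (\<lambda>m i. of_bool (z = Alpha m i))
     (- of_bool (z = Theta))"

lemma eval_integer_coeff: "eval_coeff n M r v \<eta> (integer_coeff c) = of_int c"
  unfolding eval_coeff_def integer_coeff_def by simp

lemma eval_revenue_coeff:
  assumes "i \<le> n" "j \<le> n"
  shows "eval_coeff n M r v \<eta> (revenue_coeff i c j d) = of_int c * r i + of_int d * r j"
proof -
  have *: "(\<Sum>k\<in>{0..n}. of_int (b * of_bool (k = i)) * r k) = of_int b * r i" if "i \<le> n" for b i
  proof -
    have "(\<Sum>k\<in>{0..n}. of_int (b * of_bool (k = i)) * r k)
        = (\<Sum>k\<in>{0..n}. if k = i then of_int b * r k else 0)"
      by (rule sum.cong) auto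
    then show ?thesis using that by simp
  qed
  show ?thesis
    using *[OF assms(1), of c] *[OF assms(2), of d]
    unfolding eval_coeff_def revenue_coeff_def
    by (simp add: distrib_right sum.distrib)
qed

text \<open>\<open>Start\<close>, \<open>Step\<close> and \<open>End\<close> are the rows of the path potentials, \<open>Upper\<close> and \<open>Lower\<close> bound the
  modulus of a multiplier by \<open>Tau\<close>, and \<open>Entry\<close> (for \<open>L1\<close>) or \<open>Total\<close> (for \<open>Linf\<close>) bounds the dual
  norm by \<open>Theta\<close>.\<close>

datatype dual_row = Start nat nat | Step nat nat nat nat | End nat nat
  | Upper nat nat | Lower nat nat | Entry nat nat | Total

text \<open>A named constant, lest the simplifier turn sums of unit vectors into cardinalities.\<close>

definition single :: "'a \<Rightarrow> 'a \<Rightarrow> int" where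
  "single z0 z = of_bool (z = z0)"

lemma sum_single:
  assumes "finite J" "z0 \<in> J"
  shows "(\<Sum>z\<in>J. of_int (single z0 z) * y z) = (y z0 :: real)"
proof -
  have "(\<Sum>z\<in>J. of_int (single z0 z) * y z) = (\<Sum>z\<in>J. if z = z0 then y z else 0)"
    by (rule sum.cong) (auto simp: single_def)
  then show ?thesis using assms by simp
qed

text \<open>There is no binary variable for the no-purchase option, which is always offered; the difference
  on the right compensates for this.\<close>

lemma sum_binaries:
  assumes "\<forall>b\<in>{1..n}. x b \<in> {0, 1 :: real}" "i \<le> n"
  shows "(\<Sum>b\<in>{1..n}. of_int (single i b) * x b)
    = of_bool (i \<in> decode n x) - of_bool (i = 0)"
proof (cases "i = 0")
  case True
  have "(\<Sum>b\<in>{1..n}. of_int (single i b) * x b) = 0"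
    using True by (intro sum.neutral) (auto simp: single_def)
  then show ?thesis using True by (simp add: decode_def)
next
  case False
  then have "i \<in> {1..n}" using assms(2) by auto
  then show ?thesis
    using False sum_single[of "{1..n}" i x] assms(1) by (auto simp: decode_def)
qed

context nested_history
begin

definition dual_vars :: "dual_var set" where
  "dual_vars = (\<lambda>(m, i). Alpha m i) ` ({1..M} \<times> {0..n}) \<union> (\<lambda>(m, i). Tau m i) ` ({1..M} \<times> {0..n})
     \<union> {Beta, Theta} \<union> (\<lambda>(j, m, i). Pot j m i) ` ({0..n} \<times> {1..M} \<times> {0..n})"

definition dual_rows :: "norm_kind \<Rightarrow> dual_row set" where
  "dual_rows nk =
     {Start j i | j i. j \<in> {0..n} \<and> i \<in> Ss 1} \<union>
     {Step j m k i | j m k i. j \<in> {0..n} \<and> m \<in> {1..<M} \<and> k \<in> Ss m \<and> i \<in> Ss (Suc m) \<and>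
        (i \<in> Ss m \<longrightarrow> i = k)} \<union>
     {End j i | j i. j \<in> {0..n} \<and> i \<in> Ss M} \<union>
     {Upper m i | m i. (m, i) \<in> observations} \<union> {Lower m i | m i. (m, i) \<in> observations} \<union>
     (case nk of L1 \<Rightarrow> {Entry m i | m i. (m, i) \<in> observations} | Linf \<Rightarrow> {Total})"

text \<open>In units of the largest revenue \<open>r n\<close>.\<close>

fun binary_part :: "dual_row \<Rightarrow> nat \<Rightarrow> int" where
  "binary_part (Start j i) b = - blocks j 1 i * single i b"
| "binary_part (Step j m k i) b = - blocks j (Suc m) i * single i b"
| "binary_part (End j i) b = single j b"
| "binary_part _ b = 0"

fun dual_part :: "dual_row \<Rightarrow> dual_var \<Rightarrow> int" where
  "dual_part (Start j i) z = single Beta z + single (Alpha 1 i) z - single (Pot j 1 i) z"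
| "dual_part (Step j m k i) z =
     single (Pot j m k) z + single (Alpha (Suc m) i) z - single (Pot j (Suc m) i) z"
| "dual_part (End j i) z = single (Pot j M i) z"
| "dual_part (Upper m i) z = single (Alpha m i) z - single (Tau m i) z"
| "dual_part (Lower m i) z = - single (Alpha m i) z - single (Tau m i) z"
| "dual_part (Entry m i) z = single (Tau m i) z - single Theta z"
| "dual_part Total z = (\<Sum>(m, i)\<in>observations. single (Tau m i) z) - single Theta z"

text \<open>For \<open>i = 0\<close> or \<open>j = 0\<close> the term that would multiply a binary variable is a constant and moves to the
  right-hand side.\<close>

fun bound_part :: "dual_row \<Rightarrow> affine_coeff" where
  "bound_part (Start j i) = revenue_coeff n (blocks j 1 i * of_bool (i = 0)) 0 0"
| "bound_part (Step j m k i) = revenue_coeff n (blocks j (Suc m) i * of_bool (i = 0)) 0 0"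
| "bound_part (End j i) = revenue_coeff n (of_bool (j \<noteq> 0)) j 1"
| "bound_part _ = integer_coeff 0"

definition row_holds ::
  "(nat \<Rightarrow> real) \<Rightarrow> (nat \<Rightarrow> nat \<Rightarrow> real) \<Rightarrow> real \<Rightarrow> (nat \<Rightarrow> real) \<Rightarrow> (dual_var \<Rightarrow> real)
     \<Rightarrow> dual_row \<Rightarrow> bool" where
  "row_holds r v \<eta> x y k \<longleftrightarrow>
     (\<Sum>b\<in>{1..n}. eval_coeff n M r v \<eta> (revenue_coeff n (binary_part k b) 0 0) * x b) +
     (\<Sum>z\<in>dual_vars. eval_coeff n M r v \<eta> (integer_coeff (dual_part k z)) * y z)
       \<le> eval_coeff n M r v \<eta> (bound_part k)"

lemma finite_dual_vars: "finite dual_vars"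
  unfolding dual_vars_def by simp

lemma observations_le: "(m, i) \<in> observations \<Longrightarrow> m \<in> {1..M} \<and> i \<le> n"
  using subsetD[OF Ss_subset, of m i] unfolding observations_def by simp

lemma mem_dual_vars:
  "m \<in> {1..M} \<Longrightarrow> i \<le> n \<Longrightarrow> Alpha m i \<in> dual_vars"
  "m \<in> {1..M} \<Longrightarrow> i \<le> n \<Longrightarrow> Tau m i \<in> dual_vars"
  "Beta \<in> dual_vars" "Theta \<in> dual_vars"
  "j \<le> n \<Longrightarrow> m \<in> {1..M} \<Longrightarrow> i \<le> n \<Longrightarrow> Pot j m i \<in> dual_vars"
  unfolding dual_vars_def by force+

lemma row_holds_iff:
  assumes r: "valid_revenues n r" and x: "\<forall>b\<in>{1..n}. x b \<in> {0, 1}"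
  defines "S \<equiv> decode n x"
  shows "\<lbrakk>j \<le> n; i \<in> Ss 1\<rbrakk> \<Longrightarrow> row_holds r v \<eta> x y (Start j i) \<longleftrightarrow>
      y Beta + step_gain r S y j 1 i \<le> y (Pot j 1 i)"
    and "\<lbrakk>j \<le> n; m \<in> {1..<M}; k \<in> Ss m; i \<in> Ss (Suc m)\<rbrakk> \<Longrightarrow>
      row_holds r v \<eta> x y (Step j m k i) \<longleftrightarrow>
      y (Pot j m k) + step_gain r S y j (Suc m) i \<le> y (Pot j (Suc m) i)"
    and "\<lbrakk>j \<le> n; i \<in> Ss M\<rbrakk> \<Longrightarrow> row_holds r v \<eta> x y (End j i) \<longleftrightarrow>
      y (Pot j M i) \<le> r j + r n * of_bool (j \<notin> S)"
    and "(m, i) \<in> observations \<Longrightarrow>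
      row_holds r v \<eta> x y (Upper m i) \<longleftrightarrow> y (Alpha m i) \<le> y (Tau m i)"
    and "(m, i) \<in> observations \<Longrightarrow>
      row_holds r v \<eta> x y (Lower m i) \<longleftrightarrow> - y (Alpha m i) \<le> y (Tau m i)"
    and "(m, i) \<in> observations \<Longrightarrow>
      row_holds r v \<eta> x y (Entry m i) \<longleftrightarrow> y (Tau m i) \<le> y Theta"
    and "row_holds r v \<eta> x y Total \<longleftrightarrow> (\<Sum>(m, i)\<in>observations. y (Tau m i)) \<le> y Theta"
proof -
  let ?E = "eval_coeff n M r v \<eta>"
  let ?X = "\<lambda>f. \<Sum>b\<in>{1..n}. ?E (revenue_coeff n (f b) 0 0) * x b"
  let ?Y = "\<lambda>f. \<Sum>z\<in>dual_vars. ?E (integer_coeff (f z)) * y z"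
  have X: "?X (\<lambda>b. c * single i b) = of_int c * r n * (of_bool (i \<in> S) - of_bool (i = 0))"
    if "i \<le> n" for c i
  proof -
    have "?X (\<lambda>b. c * single i b) = of_int c * r n * (\<Sum>b\<in>{1..n}. of_int (single i b) * x b)"
      by (simp add: eval_revenue_coeff sum_distrib_left ac_simps)
    then show ?thesis unfolding S_def sum_binaries[OF x that] .
  qed
  have X0: "?X (\<lambda>b. 0) = 0" by (simp add: eval_revenue_coeff)
  have Y: "?Y f = (\<Sum>z\<in>dual_vars. of_int (f z) * y z)" for f
    by (simp add: eval_integer_coeff)
  have r0: "r 0 = 0" using r unfolding valid_revenues_def by simp
  note expand = row_holds_def binary_part.simps dual_part.simps bound_part.simps
  note lin = left_diff_distrib distrib_right sum.distrib sum_subtractf sum_negf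
    sum_single[OF finite_dual_vars] mem_dual_vars
  show "row_holds r v \<eta> x y (Start j i) \<longleftrightarrow>
      y Beta + step_gain r S y j 1 i \<le> y (Pot j 1 i)" if h: "j \<le> n" "i \<in> Ss 1"
  proof -
    have i: "i \<le> n" using Ss_le[of i 1] h M_pos by simp
    have "?Y (dual_part (Start j i)) = y Beta + y (Alpha 1 i) - y (Pot j 1 i)"
      unfolding Y using h i M_pos by (simp add: lin)
    moreover have "?X (binary_part (Start j i))
        = - of_int (blocks j 1 i) * r n * (of_bool (i \<in> S) - of_bool (i = 0))"
      using X[OF i, of "- blocks j 1 i"] by simp
    moreover have "?E (bound_part (Start j i)) = of_int (blocks j 1 i) * of_bool (i = 0) * r n"
      using r0 by (simp add: eval_revenue_coeff)
    ultimately show ?thesis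
      unfolding row_holds_def step_gain_def by (simp only:) (simp add: algebra_simps)
  qed
  show "row_holds r v \<eta> x y (Step j m k i) \<longleftrightarrow>
      y (Pot j m k) + step_gain r S y j (Suc m) i \<le> y (Pot j (Suc m) i)"
    if h: "j \<le> n" "m \<in> {1..<M}" "k \<in> Ss m" "i \<in> Ss (Suc m)"
  proof -
    have i: "i \<le> n" "k \<le> n" using Ss_le[of i "Suc m"] Ss_le[of k m] h by auto
    have "?Y (dual_part (Step j m k i)) = y (Pot j m k) + y (Alpha (Suc m) i) - y (Pot j (Suc m) i)"
      unfolding Y using h i by (simp add: lin)
    moreover have "?X (binary_part (Step j m k i))
        = - of_int (blocks j (Suc m) i) * r n * (of_bool (i \<in> S) - of_bool (i = 0))"
      using X[OF i(1), of "- blocks j (Suc m) i"] by simp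
    moreover have "?E (bound_part (Step j m k i))
        = of_int (blocks j (Suc m) i) * of_bool (i = 0) * r n"
      using r0 by (simp add: eval_revenue_coeff)
    ultimately show ?thesis
      unfolding row_holds_def step_gain_def by (simp only:) (simp add: algebra_simps)
  qed
  show "row_holds r v \<eta> x y (End j i) \<longleftrightarrow> y (Pot j M i) \<le> r j + r n * of_bool (j \<notin> S)"
    if h: "j \<le> n" "i \<in> Ss M"
  proof -
    have i: "i \<le> n" using Ss_le[of i M] h M_pos by simp
    have "?Y (dual_part (End j i)) = y (Pot j M i)"
      unfolding Y using h i M_pos by (simp add: lin)
    moreover have "?X (binary_part (End j i)) = r n * (of_bool (j \<in> S) - of_bool (j = 0))"
      using X[OF h(1), of 1] by simp
    moreover have "?E (bound_part (End j i)) = of_bool (j \<noteq> 0) * r n + r j"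
      using h by (simp add: eval_revenue_coeff)
    moreover have "0 \<in> S" unfolding S_def decode_def by simp
    ultimately show ?thesis
      unfolding row_holds_def by (simp only:) (auto simp: algebra_simps)
  qed
  show "row_holds r v \<eta> x y (Upper m i) \<longleftrightarrow> y (Alpha m i) \<le> y (Tau m i)"
    "row_holds r v \<eta> x y (Lower m i) \<longleftrightarrow> - y (Alpha m i) \<le> y (Tau m i)"
    "row_holds r v \<eta> x y (Entry m i) \<longleftrightarrow> y (Tau m i) \<le> y Theta"
    if "(m, i) \<in> observations"
    using observations_le[OF that] unfolding expand X0 Y eval_integer_coeff
    by (auto simp: lin)
  have "(\<Sum>z\<in>dual_vars. (\<Sum>(m, i)\<in>observations. of_int (single (Tau m i) z)) * y z)
      = (\<Sum>(m, i)\<in>observations. \<Sum>z\<in>dual_vars. of_int (single (Tau m i) z) * y z)"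
    unfolding sum_distrib_right by (subst sum.swap) (simp add: case_prod_unfold)
  also have "\<dots> = (\<Sum>(m, i)\<in>observations. y (Tau m i))"
    by (intro sum.cong) (auto simp: sum_single[OF finite_dual_vars] mem_dual_vars
        dest!: observations_le)
  finally show "row_holds r v \<eta> x y Total \<longleftrightarrow> (\<Sum>(m, i)\<in>observations. y (Tau m i)) \<le> y Theta"
    unfolding expand X0 Y eval_integer_coeff
    by (simp add: lin case_prod_unfold)
qed

lemma rows_hold_iff:
  assumes r: "valid_revenues n r" and x: "\<forall>b\<in>{1..n}. x b \<in> {0, 1}"
  shows "(\<forall>k\<in>dual_rows nk. row_holds r v \<eta> x y k) \<longleftrightarrow>
    path_bound r (decode n x) y \<and> dominates_dual_norm nk y"
proof -
  define H where "H = row_holds r v \<eta> x y"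
  have "(\<forall>k\<in>dual_rows nk. H k) \<longleftrightarrow>
     (\<forall>j\<in>{0..n}. (\<forall>i\<in>Ss 1. H (Start j i)) \<and>
        (\<forall>m\<in>{1..<M}. \<forall>k\<in>Ss m. \<forall>i\<in>Ss (Suc m). (i \<in> Ss m \<longrightarrow> i = k) \<longrightarrow> H (Step j m k i)) \<and>
        (\<forall>i\<in>Ss M. H (End j i))) \<and>
     (\<forall>(m, i)\<in>observations. H (Upper m i) \<and> H (Lower m i)) \<and>
     (case nk of L1 \<Rightarrow> \<forall>(m, i)\<in>observations. H (Entry m i) | Linf \<Rightarrow> H Total)"
    (is "?all \<longleftrightarrow> ?path \<and> ?abs \<and> ?norm")
  proof
    assume ?all
    then have H: "H k" if "k \<in> dual_rows nk" for k using that by blast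
    have ?path by (intro ballI conjI impI H) (auto simp: dual_rows_def)
    moreover have ?abs by (auto intro!: H simp: dual_rows_def)
    moreover have ?norm by (cases nk) (auto intro!: H simp: dual_rows_def)
    ultimately show "?path \<and> ?abs \<and> ?norm" by blast
  next
    assume rows: "?path \<and> ?abs \<and> ?norm"
    show ?all
    proof
      fix k assume "k \<in> dual_rows nk"
      then show "H k" using rows by (cases nk; cases k) (auto simp: dual_rows_def)
    qed
  qed
  also have "(\<forall>j\<in>{0..n}. (\<forall>i\<in>Ss 1. H (Start j i)) \<and>
      (\<forall>m\<in>{1..<M}. \<forall>k\<in>Ss m. \<forall>i\<in>Ss (Suc m). (i \<in> Ss m \<longrightarrow> i = k) \<longrightarrow> H (Step j m k i)) \<and>
      (\<forall>i\<in>Ss M. H (End j i))) \<longleftrightarrow> path_bound r (decode n x) y"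
    unfolding path_bound_def H_def
    by (intro ball_cong conj_cong imp_cong refl row_holds_iff[OF r x]) auto
  also have "(\<forall>(m, i)\<in>observations. H (Upper m i) \<and> H (Lower m i)) \<longleftrightarrow>
      (\<forall>(m, i)\<in>observations. \<bar>y (Alpha m i)\<bar> \<le> y (Tau m i))"
    by (rule ball_cong) (auto simp: H_def row_holds_iff(4,5)[OF r x] abs_le_iff)
  also have "(\<forall>(m, i)\<in>observations. H (Entry m i)) \<longleftrightarrow>
      (\<forall>(m, i)\<in>observations. y (Tau m i) \<le> y Theta)"
    by (rule ball_cong) (auto simp: H_def row_holds_iff(6)[OF r x])
  also have "H Total \<longleftrightarrow> (\<Sum>(m, i)\<in>observations. y (Tau m i)) \<le> y Theta"
    unfolding H_def by (rule row_holds_iff(7)[OF r x])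
  finally show ?thesis unfolding H_def dominates_dual_norm_def .
qed

lemma eval_dual_value_coeff:
  "(\<Sum>z\<in>dual_vars. eval_coeff n M r v \<eta> (dual_value_coeff z) * y z) = dual_value v \<eta> y"
proof -
  have "eval_coeff n M r v \<eta> (dual_value_coeff z) = of_int (single Beta z)
      + (\<Sum>m\<in>{1..M}. \<Sum>i\<in>{0..n}. of_int (single (Alpha m i) z) * v m i)
      - of_int (single Theta z) * \<eta>" for z
    unfolding eval_coeff_def dual_value_coeff_def single_def by simp
  moreover have "(\<Sum>z\<in>dual_vars.
      (\<Sum>m\<in>{1..M}. \<Sum>i\<in>{0..n}. of_int (single (Alpha m i) z) * v m i) * y z)
      = (\<Sum>m\<in>{1..M}. \<Sum>i\<in>{0..n}. v m i * y (Alpha m i))"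
  proof -
    have "(\<Sum>z\<in>dual_vars.
        (\<Sum>m\<in>{1..M}. \<Sum>i\<in>{0..n}. of_int (single (Alpha m i) z) * v m i) * y z)
      = (\<Sum>m\<in>{1..M}. \<Sum>z\<in>dual_vars. \<Sum>i\<in>{0..n}. of_int (single (Alpha m i) z) * v m i * y z)"
      unfolding sum_distrib_right by (rule sum.swap)
    also have "\<dots> = (\<Sum>m\<in>{1..M}. \<Sum>i\<in>{0..n}.
        \<Sum>z\<in>dual_vars. of_int (single (Alpha m i) z) * v m i * y z)"
      by (intro sum.cong refl sum.swap)
    also have "\<dots> = (\<Sum>m\<in>{1..M}. \<Sum>i\<in>{0..n}.
        v m i * (\<Sum>z\<in>dual_vars. of_int (single (Alpha m i) z) * y z))"
      by (simp add: sum_distrib_left ac_simps)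
    also have "\<dots> = (\<Sum>m\<in>{1..M}. \<Sum>i\<in>{0..n}. v m i * y (Alpha m i))"
      by (intro sum.cong) (auto simp: sum_single[OF finite_dual_vars] mem_dual_vars)
    finally show ?thesis .
  qed
  moreover have "(\<Sum>z\<in>dual_vars. of_int (single Theta z) * \<eta> * y z) = \<eta> * y Theta"
    using sum_single[OF finite_dual_vars mem_dual_vars(4), of "\<lambda>z. \<eta> * y z"]
    by (simp add: mult.assoc)
  ultimately show ?thesis
    unfolding dual_value_def
    by (simp add: left_diff_distrib distrib_right sum.distrib sum_subtractf
        sum_single[OF finite_dual_vars mem_dual_vars(3)])
qed

lemma card_dual_vars: "card dual_vars \<le> 7 * (n + M) ^ 4"
proof -
  let ?N = "n + M"
  have N: "Suc n \<le> ?N" "M \<le> ?N" "1 \<le> ?N" using M_pos by auto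
  have A: "card (f ` ({1..M} \<times> {0..n})) \<le> ?N ^ 4" for f :: "nat \<times> nat \<Rightarrow> dual_var"
  proof -
    have "card (f ` ({1..M} \<times> {0..n})) \<le> M * Suc n"
      using card_image_le[of "{1..M} \<times> {0..n}" f] by simp
    also have "\<dots> \<le> ?N ^ 2" unfolding power2_eq_square using N by (intro mult_mono) auto
    also have "\<dots> \<le> ?N ^ 4" using N by (intro power_increasing) auto
    finally show ?thesis .
  qed
  have B: "card ((\<lambda>(j, m, i). Pot j m i) ` ({0..n} \<times> {1..M} \<times> {0..n})) \<le> ?N ^ 4"
  proof -
    have "card ((\<lambda>(j, m, i). Pot j m i) ` ({0..n} \<times> {1..M} \<times> {0..n})) \<le> Suc n * (M * Suc n)"
      using card_image_le[of "{0..n} \<times> {1..M} \<times> {0..n}" "\<lambda>(j, m, i). Pot j m i"] by simp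
    also have "\<dots> \<le> ?N * (?N * ?N)" using N by (intro mult_mono) auto
    also have "\<dots> = ?N ^ 3" by (simp add: power3_eq_cube)
    also have "\<dots> \<le> ?N ^ 4" using N by (intro power_increasing) auto
    finally show ?thesis .
  qed
  have C: "card {Beta, Theta} \<le> 2 * ?N ^ 4" using one_le_power[OF N(3), of 4] by simp
  have "card dual_vars \<le> ?N ^ 4 + ?N ^ 4 + 2 * ?N ^ 4 + ?N ^ 4"
    unfolding dual_vars_def
    by (intro order_trans[OF card_Un_le] add_mono A B C)
  then show ?thesis by simp
qed

text \<open>There are seven families of rows, none with more than four indices, and each index ranges over
  at most \<open>n + M\<close> values because \<open>M \<ge> 1\<close>.\<close>

lemma dual_rows_bound: "finite (dual_rows nk) \<and> card (dual_rows nk) \<le> 7 * (n + M) ^ 4"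
proof -
  let ?N = "n + M"
  let ?I = "{0..n}" and ?T = "{1..M}"
  let ?G = "case_prod Start ` (?I \<times> ?I) \<union> (\<lambda>(j, m, k, i). Step j m k i) ` (?I \<times> ?T \<times> ?I \<times> ?I)
    \<union> case_prod End ` (?I \<times> ?I) \<union> case_prod Upper ` (?T \<times> ?I) \<union> case_prod Lower ` (?T \<times> ?I)
    \<union> case_prod Entry ` (?T \<times> ?I) \<union> {Total}"
  have N: "Suc n \<le> ?N" "M \<le> ?N" "1 \<le> ?N" using M_pos by auto
  have sub: "dual_rows nk \<subseteq> ?G"
  proof
    fix k assume k: "k \<in> dual_rows nk"
    have 1: "1 \<in> {1..M}" "M \<in> {1..M}" using M_pos by auto
    show "k \<in> ?G"
    proof (cases k)
      case (Step j m k' i)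
      then have "j \<in> ?I" "m \<in> {1..<M}" "k' \<in> Ss m" "i \<in> Ss (Suc m)"
        using k unfolding dual_rows_def by (auto split: norm_kind.splits)
      then have "(j, m, k', i) \<in> ?I \<times> ?T \<times> ?I \<times> ?I"
        using Ss_le[of k' m] Ss_le[of i "Suc m"] by auto
      then show ?thesis unfolding Step by (force simp: image_iff)
    qed (use k 1 in \<open>auto simp: dual_rows_def image_iff dest: Ss_le observations_le
      split: norm_kind.splits\<close>)
  qed
  have two: "card (f ` (A \<times> ?I)) \<le> ?N ^ 4" if "A = ?I \<or> A = ?T"
    for f :: "nat \<times> nat \<Rightarrow> dual_row" and A
  proof -
    have "card (f ` (A \<times> ?I)) \<le> card A * Suc n"
      using card_image_le[of "A \<times> ?I" f] that by auto
    also have "\<dots> \<le> ?N * ?N" using N that by (intro mult_mono) auto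
    also have "\<dots> = ?N ^ 2" by (simp add: power2_eq_square)
    also have "\<dots> \<le> ?N ^ 4" using N by (intro power_increasing) auto
    finally show ?thesis .
  qed
  have four: "card ((\<lambda>(j, m, k, i). Step j m k i) ` (?I \<times> ?T \<times> ?I \<times> ?I)) \<le> ?N ^ 4"
  proof -
    have "card ((\<lambda>(j, m, k, i). Step j m k i) ` (?I \<times> ?T \<times> ?I \<times> ?I))
        \<le> Suc n * (M * (Suc n * Suc n))"
      using card_image_le[of "?I \<times> ?T \<times> ?I \<times> ?I" "\<lambda>(j, m, k, i). Step j m k i"] by simp
    also have "\<dots> \<le> ?N * (?N * (?N * ?N))" using N by (intro mult_mono) auto
    also have "\<dots> = ?N ^ 4" by (simp add: eval_nat_numeral)
    finally show ?thesis .
  qed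
  have one: "card {Total} \<le> ?N ^ 4" using one_le_power[OF N(3), of 4] by simp
  have "card ?G \<le> ?N ^ 4 + ?N ^ 4 + ?N ^ 4 + ?N ^ 4 + ?N ^ 4 + ?N ^ 4 + ?N ^ 4"
    by (intro order_trans[OF card_Un_le] add_mono two four one) simp_all
  moreover have "finite ?G" by simp
  ultimately show ?thesis
    using card_mono[OF _ sub] finite_subset[OF sub] by force
qed

lemma worst_case_le_revenue:
  assumes r: "valid_revenues n r" and S: "S \<in> assortments n"
    and l: "l \<in> uncertainty_set nk n M Ss v \<eta>"
  shows "worst_case_revenue n r (uncertainty_set nk n M Ss v \<eta>) S \<le> revenue n r l S"
  unfolding worst_case_revenue_def
proof (rule cINF_lower[OF _ l])
  have fav: "favourite \<sigma> S \<le> n" for \<sigma>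
    using favourite_in[of S \<sigma>] S unfolding assortments_def by force
  have "0 \<le> revenue n r l' S" if "l' \<in> uncertainty_set nk n M Ss v \<eta>" for l'
    unfolding revenue_favourite[OF S]
    using that revenue_bounds(1)[OF r fav]
    by (intro sum_nonneg mult_nonneg_nonneg) (auto simp: uncertainty_set_def ranking_dists_def)
  then show "bdd_below ((\<lambda>l. revenue n r l S) ` uncertainty_set nk n M Ss v \<eta>)"
    by (intro bdd_belowI[of _ 0]) auto
qed

text \<open>Since the rows encode \<open>path_bound\<close> and \<open>dominates_dual_norm\<close>, soundness is weak duality and
  completeness is strong duality followed by the choice of longest-path potentials.\<close>

lemma robust_milp_exists:
  obtains P where "nbin P = n" "ncont P = card dual_vars" "ncon P = card (dual_rows nk)"
    "\<And>r v \<eta>. \<lbrakk>valid_revenues n r; valid_sales n M Ss v; uncertainty_set nk n M Ss v \<eta> \<noteq> {}\<rbrakk> \<Longrightarrow>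
      reformulates (map_milp (eval_coeff n M r v \<eta>) P) n r (uncertainty_set nk n M Ss v \<eta>)"
proof -
  obtain P where P: "nbin P = n" "ncont P = card dual_vars" "ncon P = card (dual_rows nk)"
    and from_milp: "\<And>E x y. milp_feasible (map_milp E P) x y \<Longrightarrow> \<exists>y'.
       (\<forall>b\<in>{1..n}. x b \<in> {0, 1}) \<and>
       (\<forall>k\<in>dual_rows nk. (\<Sum>b\<in>{1..n}. E (revenue_coeff n (binary_part k b) 0 0) * x b)
          + (\<Sum>z\<in>dual_vars. E (integer_coeff (dual_part k z)) * y' z) \<le> E (bound_part k)) \<and>
       milp_objective (map_milp E P) x y
         = (\<Sum>b\<in>{1..n}. E (integer_coeff 0) * x b) + (\<Sum>z\<in>dual_vars. E (dual_value_coeff z) * y' z)"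
    and to_milp: "\<And>E x y'. (\<forall>b\<in>{1..n}. x b \<in> {0, 1}) \<Longrightarrow>
       (\<forall>k\<in>dual_rows nk. (\<Sum>b\<in>{1..n}. E (revenue_coeff n (binary_part k b) 0 0) * x b)
          + (\<Sum>z\<in>dual_vars. E (integer_coeff (dual_part k z)) * y' z) \<le> E (bound_part k)) \<Longrightarrow>
       \<exists>y. milp_feasible (map_milp E P) x y \<and> milp_objective (map_milp E P) x y
         = (\<Sum>b\<in>{1..n}. E (integer_coeff 0) * x b) + (\<Sum>z\<in>dual_vars. E (dual_value_coeff z) * y' z)"
    using milp_from_indexed_rows[where nb = n and J = dual_vars and K = "dual_rows nk"
      and ob = "\<lambda>_. integer_coeff 0" and oc = dual_value_coeff and rh = bound_part
      and rb = "\<lambda>k b. revenue_coeff n (binary_part k b) 0 0"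
      and rc = "\<lambda>k z. integer_coeff (dual_part k z)", OF finite_dual_vars]
      dual_rows_bound by blast
  show thesis
  proof (rule that[OF P])
    fix r v \<eta>
    assume r: "valid_revenues n r" and v: "valid_sales n M Ss v"
      and U: "uncertainty_set nk n M Ss v \<eta> \<noteq> {}"
    let ?E = "eval_coeff n M r v \<eta>" and ?U = "uncertainty_set nk n M Ss v \<eta>"
    have zero: "(\<Sum>b\<in>{1..n}. ?E (integer_coeff 0) * x b) = 0" for x
      by (simp add: eval_integer_coeff)
    note fold_rows = row_holds_def[symmetric] eval_dual_value_coeff zero
    show "reformulates (map_milp ?E P) n r ?U"
    proof (rule reformulatesI)
      show "n \<le> nbin (map_milp ?E P)" using P(1) by (cases P) simp
    next
      fix x y assume "milp_feasible (map_milp ?E P) x y"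
      from from_milp[OF this] obtain y' where x: "\<forall>b\<in>{1..n}. x b \<in> {0, 1}"
        and rows: "\<forall>k\<in>dual_rows nk. row_holds r v \<eta> x y' k"
        and obj: "milp_objective (map_milp ?E P) x y = dual_value v \<eta> y'"
        unfolding fold_rows by auto
      have y': "path_bound r (decode n x) y'" "dominates_dual_norm nk y'"
        using rows unfolding rows_hold_iff[OF r x] by auto
      have "dual_value v \<eta> y' \<le> worst_case_revenue n r ?U (decode n x)"
        unfolding worst_case_revenue_def
        using dual_value_le_revenue[OF v decode_in_assortments _ y'(2)
            path_bound_imp_ranking_bound[OF y'(1) decode_in_assortments]]
        by (intro cINF_greatest[OF U])
      then show "milp_objective (map_milp ?E P) x y \<le> worst_case_revenue n r ?U (decode n x)"
        using obj by simp
    next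
      fix S assume S: "S \<in> assortments n"
      define x :: "nat \<Rightarrow> real" where "x = (\<lambda>i. of_bool (i \<in> S))"
      have x: "\<forall>b\<in>{1..n}. x b \<in> {0, 1}" unfolding x_def by simp
      have dec: "decode n x = S" unfolding x_def by (rule decode_of_bool[OF S])
      obtain y where y: "dominates_dual_norm nk y" "ranking_bound r S y"
        "worst_case_revenue n r ?U S \<le> dual_value v \<eta> y"
        using dual_certificate_exists[OF v S worst_case_le_revenue[OF r S]] by blast
      obtain y' where y': "path_bound r S y'" "\<And>z. \<forall>j m i. z \<noteq> Pot j m i \<Longrightarrow> y' z = y z"
        using ranking_bound_imp_path_bound[OF r S y(2)] by blast
      have "dominates_dual_norm nk y'"
        using y(1) unfolding dominates_dual_norm_def by (cases nk) (simp_all add: y'(2))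
      then have rows: "\<forall>k\<in>dual_rows nk. row_holds r v \<eta> x y' k"
        unfolding rows_hold_iff[OF r x] dec using y'(1) by blast
      have val: "dual_value v \<eta> y' = dual_value v \<eta> y"
        unfolding dual_value_def by (simp add: y'(2))
      from to_milp[OF x, of ?E y'] rows obtain y'' where "milp_feasible (map_milp ?E P) x y''"
        "milp_objective (map_milp ?E P) x y'' = dual_value v \<eta> y"
        unfolding fold_rows val by auto
      then show "\<exists>x y. milp_feasible (map_milp ?E P) x y \<and> decode n x = S \<and>
          worst_case_revenue n r ?U S \<le> milp_objective (map_milp ?E P) x y"
        using dec y(3) by metis
    qed
  qed
qed

end

theorem theorem5:
  shows "\<exists>C d :: nat. \<forall>(nk :: norm_kind) (n :: nat) (M :: nat) (Ss :: nat \<Rightarrow> nat set).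
    past_assortments n M Ss \<longrightarrow> nested M Ss \<longrightarrow> (\<forall>m\<in>{1..M}. Ss m \<in> assortments n) \<longrightarrow>
    (\<exists>P :: affine_coeff milp.
       nbin P \<le> C * n \<and> ncont P \<le> C * (n + M) ^ d \<and> ncon P \<le> C * (n + M) ^ d \<and>
       (\<forall>(r :: nat \<Rightarrow> real) (v :: nat \<Rightarrow> nat \<Rightarrow> real) (\<eta> :: real).
          valid_revenues n r \<longrightarrow> valid_sales n M Ss v \<longrightarrow> 0 \<le> \<eta> \<longrightarrow>
          uncertainty_set nk n M Ss v \<eta> \<noteq> {} \<longrightarrow>
          reformulates (map_milp (eval_coeff n M r v \<eta>) P) n r
            (uncertainty_set nk n M Ss v \<eta>)))"
proof (rule exI[of _ 7], rule exI[of _ 4], intro allI impI)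
  fix nk :: norm_kind and n M :: nat and Ss :: "nat \<Rightarrow> nat set"
  assume "past_assortments n M Ss" "nested M Ss" "\<forall>m\<in>{1..M}. Ss m \<in> assortments n"
  then interpret nested_history n M Ss by unfold_locales
  obtain P where P: "nbin P = n" "ncont P = card dual_vars" "ncon P = card (dual_rows nk)"
    "\<And>r v \<eta>. \<lbrakk>valid_revenues n r; valid_sales n M Ss v; uncertainty_set nk n M Ss v \<eta> \<noteq> {}\<rbrakk> \<Longrightarrow>
      reformulates (map_milp (eval_coeff n M r v \<eta>) P) n r (uncertainty_set nk n M Ss v \<eta>)"
    using robust_milp_exists by blast
  show "\<exists>P :: affine_coeff milp.
       nbin P \<le> 7 * n \<and> ncont P \<le> 7 * (n + M) ^ 4 \<and> ncon P \<le> 7 * (n + M) ^ 4 \<and>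
       (\<forall>(r :: nat \<Rightarrow> real) (v :: nat \<Rightarrow> nat \<Rightarrow> real) (\<eta> :: real).
          valid_revenues n r \<longrightarrow> valid_sales n M Ss v \<longrightarrow> 0 \<le> \<eta> \<longrightarrow>
          uncertainty_set nk n M Ss v \<eta> \<noteq> {} \<longrightarrow>
          reformulates (map_milp (eval_coeff n M r v \<eta>) P) n r
            (uncertainty_set nk n M Ss v \<eta>))"
    using P card_dual_vars dual_rows_bound[of nk] by (intro exI[of _ P]) simp
qed

end
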